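(* Let $\mathcal{D}=\{\alpha_1,\ldots,\alpha_m\}$ be a dissection of a convex $n$-gon $P_n$ of type $\{d_1,\ldots,d_m\}$, with associated indeterminates $x_1,\ldots,x_m$, respectively. Set $c=\prod_{i=1}^m x_i^{d_i-2}$. Let $W_{\mathcal{D}}(x_1,\ldots,x_m)$ be the corresponding weight matrix. Then $$\det W_{\mathcal{D}}(x_1,\ldots,x_m)=(-1)^{n-1}\prod_{i=1}^m\sum_{j=0}^{d_i-2}(c x_i^2)^j=(-1)^{n-1}\prod_{i=1}^m\frac{(c x_i^2)^{d_i-1}-1}{c x_i^2-1}.$$
   Context: $P_n$ is a convex $n$-gon ($n\ge3$) with vertices labelled $1,2,\ldots,n$ in counterclockwise order, labels being taken modulo $n$. A dissection $\mathcal{D}$ of $P_n$ is obtained by drawing $m-1$ ($m\ge 1$) pairwise noncrossing diagonals, which cut $P_n$ into $m$ polygons $\alpha_1,\ldots,\alpha_m$, called the pieces of the dissection; one writes $\mathcal{D}=\{\alpha_1,\ldots,\alpha_m\}$. If $\alpha_l$ has $d_l$ vertices, it is called a piece of degree $d_l$; the multiset $\{d_1,\ldots,d_m\}$ is the type of $\mathcal{D}$. For vertices $i,j$, a (counterclockwise) walk from $i$ to $j$ around $P_n$ is a sequence $w=(p_{i+1},p_{i+2},\ldots,p_{j-1})$ of pieces of $\mathcal{D}$, indexed by the vertices strictly between $i$ and $j$ when going counterclockwise from $i$ to $j$ (labels modulo $n$), such that: (i) $p_k$ is incident to vertex $k$ (i.e. $k$ is a vertex of $p_k$) for all $k\in\{i+1,\ldots,j-1\}$;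 (ii) each piece $\alpha\in\mathcal{D}$ of degree $d$ appears at most $d-2$ times among $p_{i+1},\ldots,p_{j-1}$. By convention, for $i=j$ there is no walk from $i$ to $i$; for $j=i+1$ (modulo $n$) the empty sequence is the unique walk from $i$ to $i+1$. To each piece $\alpha_l$ an indeterminate $x_l=x(\alpha_l)$ is associated. The weight of a walk $w=(p_{i+1},\ldots,p_{j-1})$ is the monomial $x^w=\prod_{k=i+1}^{j-1}x(p_k)$ (the empty walk has weight $1$). The weight matrix $W_{\mathcal{D}}(x_1,\ldots,x_m)=(w_{i,j})_{1\le i,j\le n}$ has entries $w_{i,j}=\sum_{w} x^w\in\mathbb{Z}[x_1,\ldots,x_m]$, the sum over all walks $w$ from $i$ to $j$ (so $w_{i,i}=0$, $w_{i,i+1}=1$). *)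

theory Defs
  imports
    "HOL-Library.Poly_Mapping"
    "HOL-Computational_Algebra.Polynomial_Factorial"
    "Jordan_Normal_Form.Determinant"
begin

text \<open>
  The vertices of the convex \<open>n\<close>-gon, in counterclockwise order, are \<open>0, \<dots>, n - 1\<close>: the vertex
  labelled \<open>k\<close> in the usual labelling \<open>1, \<dots>, n\<close> is \<open>k - 1\<close> here, so that vertices are at the same
  time row and column indices of matrices. A polygon spanned by vertices of the \<open>n\<close>-gon is
  identified with its set of vertices.
\<close>

definition is_diagonal :: "nat \<Rightarrow> nat \<times> nat \<Rightarrow> bool" where
  "is_diagonal n = (\<lambda>(a, b). a < b \<and> b < n \<and> b \<noteq> a + 1 \<and> \<not> (a = 0 \<and> b = n - 1))"

definition crossing :: "nat \<times> nat \<Rightarrow> nat \<times> nat \<Rightarrow> bool" where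
  "crossing = (\<lambda>(a, b) (a', b'). a < a' \<and> a' < b \<and> b < b' \<or> a' < a \<and> a < b' \<and> b' < b)"

definition dissection :: "nat \<Rightarrow> (nat \<times> nat) set \<Rightarrow> bool" where
  "dissection n D \<longleftrightarrow>
     (\<forall>e\<in>D. is_diagonal n e) \<and> (\<forall>e\<in>D. \<forall>f\<in>D. \<not> crossing e f)"

text \<open>The vertex sets of the two polygons into which a single diagonal cuts the \<open>n\<close>-gon.\<close>

definition sides :: "nat \<Rightarrow> nat \<times> nat \<Rightarrow> nat set set" where
  "sides n = (\<lambda>(a, b). {{a..b}, {0..a} \<union> {b..<n}})"

text \<open>
  The pieces cut out by the diagonals \<open>D\<close>: one side of each diagonal is chosen, and the
  intersection is a piece if it is two-dimensional. As the diagonals do not cross, the vertices of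
  such an intersection are vertices of the \<open>n\<close>-gon, and it is two-dimensional iff it has at least
  three of them.
\<close>

definition pieces :: "nat \<Rightarrow> (nat \<times> nat) set \<Rightarrow> nat set set" where
  "pieces n D =
     {P. \<exists>s. (\<forall>e\<in>D. s e \<in> sides n e) \<and> P = {0..<n} \<inter> (\<Inter>e\<in>D. s e) \<and> 3 \<le> card P}"

text \<open>
  For \<open>i \<noteq> j\<close> there are \<open>(j + n - i - 1) mod n\<close> vertices strictly between \<open>i\<close> and \<open>j\<close>
  (counterclockwise from \<open>i\<close>); entry \<open>t\<close> of a walk belongs to the vertex \<open>i + 1 + t\<close> modulo \<open>n\<close>.
\<close>

definition walks :: "nat \<Rightarrow> (nat \<times> nat) set \<Rightarrow> nat \<Rightarrow> nat \<Rightarrow> nat set list set" where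
  "walks n D i j =
     (if i = j then {}
      else {w. length w = (j + n - i - 1) mod n
             \<and> set w \<subseteq> pieces n D
             \<and> (\<forall>t<length w. (i + 1 + t) mod n \<in> w ! t)
             \<and> (\<forall>P\<in>pieces n D. count_list w P \<le> card P - 2)})"

definition walk_weight :: "(nat set \<Rightarrow> 'a::comm_ring_1) \<Rightarrow> nat set list \<Rightarrow> 'a" where
  "walk_weight x w = prod_list (map x w)"

definition weight_matrix ::
    "nat \<Rightarrow> (nat \<times> nat) set \<Rightarrow> (nat set \<Rightarrow> 'a::comm_ring_1) \<Rightarrow> 'a mat" where
  "weight_matrix n D x = mat n n (\<lambda>(i, j). \<Sum>w\<in>walks n D i j. walk_weight x w)"

text \<open>
  Integer polynomials in the indeterminates \<open>Var 0, Var 1, \<dots>\<close>, as finitely supported functions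
  from exponent vectors to coefficients; multiplication of poly mappings is convolution.
\<close>

type_synonym int_mpoly = "(nat \<Rightarrow>\<^sub>0 nat) \<Rightarrow>\<^sub>0 int"

definition Var :: "nat \<Rightarrow> int_mpoly" where
  "Var l = Poly_Mapping.single (Poly_Mapping.single l 1) 1"

end

theory Submission
  imports Defs
begin

text \<open>
  Pieces are glued on one at a time. Let \<open>W(q)\<close> be the weight matrix with all entries below the
  diagonal multiplied by \<open>q\<close>. Suppose the piece \<open>Q\<close> with new vertices \<open>E\<close> and weight \<open>x\<close> is
  glued to the edge \<open>(a, b)\<close> of a polygon with vertices \<open>V\<close> and weight matrix \<open>W'\<close>, and let
  \<open>y = x ^ |E|\<close>. A walk passing all of \<open>E\<close> uses up \<open>Q\<close> there, so the block of \<open>W(q)\<close> on \<open>V\<close> is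
  \<open>W'(q y)\<close> up to conjugation by a diagonal matrix. On the columns \<open>V\<close>, the rows belonging to \<open>E\<close> are
  linear combinations of the rows \<open>a\<close> and \<open>b\<close>, because among the old vertices only \<open>a\<close> and \<open>b\<close> can
  also use \<open>Q\<close>; the same holds for columns. The Schur complement on \<open>E\<close> is, up to scaling of rows and
  columns, the matrix with diagonal \<open>1 + \<gamma>\<close>, entries \<open>\<gamma>\<close> above and \<open>1\<close> below it, where
  \<open>\<gamma> = q c x\<^sup>2\<close>; its determinant is \<open>1 + \<gamma> + \<dots> + \<gamma> ^ |E|\<close>. Hence
  \<open>det W(q) = (-1) ^ (|V| - 1) q \<Prod>\<^sub>P \<Sum>\<^sub>j (q c x\<^sub>P\<^sup>2) ^ j\<close> by induction, starting from a single edge.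
\<close>

section \<open>Determinants of matrices padded with the identity\<close>

abbreviation det_fun :: "nat \<Rightarrow> (nat \<Rightarrow> nat \<Rightarrow> 'a::comm_ring_1) \<Rightarrow> 'a" where
  "det_fun n f \<equiv> det (mat n n (\<lambda>(i, j). f i j))"

text \<open>
  Padding with the identity keeps all matrices of size \<open>n\<close>, so that no relabelling is needed when
  the vertex set changes.
\<close>

definition identity_off :: "nat set \<Rightarrow> (nat \<Rightarrow> nat \<Rightarrow> 'a::zero_neq_one) \<Rightarrow> nat \<Rightarrow> nat \<Rightarrow> 'a" where
  "identity_off V f i j = (if i \<in> V \<and> j \<in> V then f i j else if i = j then 1 else 0)"

lemma det_fun_leibniz:
  "det_fun n f = (\<Sum>p | p permutes {0..<n}. signof p * (\<Prod>i=0..<n. f i (p i)))"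
proof -
  have "p i < n" if "p permutes {0..<n}" "i < n" for p i
    using permutes_in_image[OF that(1), of i] that(2) by simp
  thus ?thesis by (subst det_def'[of _ n]) (auto intro!: sum.cong prod.cong)
qed

lemma det_fun_cong:
  assumes "\<And>i j. i < n \<Longrightarrow> j < n \<Longrightarrow> f i j = g i j"
  shows "det_fun n f = det_fun n g"
  using assms by (intro arg_cong[where f=det] eq_matI) auto

lemma det_fun_transpose: "det_fun n (\<lambda>i j. f j i) = det_fun n f"
proof -
  have "mat n n (\<lambda>(i, j). f j i) = transpose_mat (mat n n (\<lambda>(i, j). f i j))"
    by (intro eq_matI) auto
  thus ?thesis by (metis det_transpose mat_carrier)
qed

text \<open>Every permutation takes exactly one entry from each row and each column.\<close>

lemma det_fun_scale:
  "det_fun n (\<lambda>i j. l i * f i j * u j) = (\<Prod>i=0..<n. l i) * (\<Prod>i=0..<n. u i) * det_fun n f"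
proof -
  have "(\<Prod>i=0..<n. l i * f i (p i) * u (p i))
      = (\<Prod>i=0..<n. l i) * (\<Prod>i=0..<n. u i) * (\<Prod>i=0..<n. f i (p i))"
    if "p permutes {0..<n}" for p
    using prod.permute[OF that, of u] by (simp add: prod.distrib mult_ac o_def)
  thus ?thesis
    unfolding det_fun_leibniz sum_distrib_left by (intro sum.cong) (auto simp: mult_ac)
qed

text \<open>As \<open>g k = 0\<close>, row \<open>k\<close> stays fixed, so the other rows can be
  treated one at a time; the set \<open>A\<close> in the proof holds those already treated.\<close>

lemma det_fun_add_row:
  assumes "k < n" and "g k = 0"
  shows "det_fun n (\<lambda>i j. f i j + g i * f k j) = det_fun n f"
proof -
  have "det_fun n (\<lambda>i j. f i j + (if i \<in> A then g i else 0) * f k j) = det_fun n f"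
    if "finite A" for A
    using that
  proof (induction A rule: finite_induct)
    case (insert a A)
    let ?f = "\<lambda>i j. f i j + (if i \<in> A then g i else 0) * f k j"
    show ?case
    proof (cases "a = k")
      case True
      thus ?thesis using insert assms
        by (subst insert.IH[symmetric]) (rule det_fun_cong; auto)
    next
      case False
      have "mat n n (\<lambda>(i,j). f i j + (if i \<in> insert a A then g i else 0) * f k j)
          = addrow (g a) a k (mat n n (\<lambda>(i,j). ?f i j))"
        using insert assms False by (intro eq_matI) auto
      thus ?thesis using det_addrow[OF \<open>k < n\<close> False, of _ "g a"] insert.IH by simp
    qed
  qed simp
  from this[of "{0..<n}"] show ?thesis
    using det_fun_cong[of n "\<lambda>i j. f i j + (if i \<in> {0..<n} then g i else 0) * f k j"
        "\<lambda>i j. f i j + g i * f k j"] by simp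
qed

lemma det_fun_add_col:
  assumes "k < n" and "g k = 0"
  shows "det_fun n (\<lambda>i j. f i j + g j * f i k) = det_fun n f"
  using det_fun_add_row[of k n g "\<lambda>i j. f j i"] assms
    det_fun_transpose[of n "\<lambda>i j. f i j + g j * f i k"] det_fun_transpose[of n f] by simp

lemma det_fun_lower_triangular:
  assumes "\<And>i j. i < j \<Longrightarrow> j < n \<Longrightarrow> f i j = 0"
  shows "det_fun n f = (\<Prod>i=0..<n. f i i)"
  using assms by (subst det_lower_triangular[of n]) (auto simp: prod_list_diag_prod)

lemma det_fun_row_add:
  assumes "k < n"
  shows "det_fun n (\<lambda>i j. if i = k then f j + g j else h i j)
       = det_fun n (\<lambda>i j. if i = k then f j else h i j)
       + det_fun n (\<lambda>i j. if i = k then g j else h i j)"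
proof -
  have "(\<Prod>i=0..<n. if i = k then f (p i) + g (p i) else h i (p i))
      = (\<Prod>i=0..<n. if i = k then f (p i) else h i (p i))
      + (\<Prod>i=0..<n. if i = k then g (p i) else h i (p i))" for p
    using assms by (simp add: prod.remove[of "{0..<n}" k] distrib_right)
  thus ?thesis
    unfolding det_fun_leibniz by (simp add: sum.distrib distrib_left)
qed

lemma det_fun_mult:
  "det_fun n f * det_fun n g = det_fun n (\<lambda>i j. \<Sum>k=0..<n. f i k * g k j)"
proof -
  have "mat n n (\<lambda>(i,j). f i j) * mat n n (\<lambda>(i,j). g i j)
      = mat n n (\<lambda>(i,j). \<Sum>k=0..<n. f i k * g k j)"
    by (intro eq_matI) (auto simp: scalar_prod_def)
  thus ?thesis by (metis det_mult mat_carrier)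
qed

text \<open>Thanks to the padding, a block diagonal matrix is the product of its two padded
  blocks.\<close>

lemma det_fun_block_diagonal:
  assumes "V \<inter> E = {}"
    and "\<And>i j. i \<in> V \<Longrightarrow> j \<in> E \<Longrightarrow> f i j = 0" "\<And>i j. i \<in> E \<Longrightarrow> j \<in> V \<Longrightarrow> f i j = 0"
  shows "det_fun n (identity_off (V \<union> E) f)
       = det_fun n (identity_off V f) * det_fun n (identity_off E f)"
  unfolding det_fun_mult
proof (rule det_fun_cong)
  fix i j assume ij: "i < n" "j < n"
  let ?s = "\<Sum>k=0..<n. identity_off V f i k * identity_off E f k j"
  show "identity_off (V \<union> E) f i j = ?s"
  proof (cases "i \<in> V")
    case True
    \<comment> \<open>A nonzero left factor forces \<open>k \<in> V\<close>, hence
      \<open>k \<notin> E\<close>, and there row \<open>k\<close> of the right factor is a unit row: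
      only \<open>k = j\<close> survives.\<close>
    have "?s = (\<Sum>k=0..<n. if k = j then (if j \<in> V then f i j else 0) else 0)"
      using True assms by (intro sum.cong) (auto simp: identity_off_def)
    thus ?thesis using ij True assms by (auto simp: identity_off_def)
  next
    case False
    have "?s = (\<Sum>k=0..<n. if k = i then identity_off E f i j else 0)"
      using False by (intro sum.cong) (auto simp: identity_off_def)
    thus ?thesis using ij False assms by (auto simp: identity_off_def)
  qed
qed

text \<open>Row operations with rows \<open>a\<close> and \<open>b\<close> clear the block on
  \<open>E\<close> x \<open>V\<close>. The column operations then clear \<open>V\<close> x
  \<open>E\<close>; meeting zeros in the rows of \<open>E\<close>, they leave the block on
  \<open>E\<close> alone, which is why \<open>u\<close> and \<open>v\<close> are absent from the
  result.\<close>

lemma det_fun_schur: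
  fixes f :: "nat \<Rightarrow> nat \<Rightarrow> 'a::comm_ring_1"
  assumes "V \<union> E \<subseteq> {0..<n}" and disj: "V \<inter> E = {}" and ab: "a \<in> V" "b \<in> V"
    and rows: "\<And>i j. i \<in> E \<Longrightarrow> j \<in> V \<Longrightarrow> f i j = g i * f a j + h i * f b j"
    and cols: "\<And>i j. i \<in> V \<Longrightarrow> j \<in> E \<Longrightarrow> f i j = u j * f i a + v j * f i b"
  shows "det_fun n (identity_off (V \<union> E) f) = det_fun n (identity_off V f)
       * det_fun n (identity_off E (\<lambda>i j. f i j - g i * f a j - h i * f b j))"
proof -
  \<comment> \<open>The multipliers vanish at \<open>a\<close> and \<open>b\<close>, as required for
    adding multiples of these rows and columns.\<close>
  define on where "on z i = (if i \<in> E then - z i else 0)" for z :: "nat \<Rightarrow> 'a" and i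
  have on: "on z a = 0" "on z b = 0" for z using ab disj by (auto simp: on_def)
  have n: "a < n" "b < n" using ab assms(1) by auto
  define f0 where "f0 = identity_off (V \<union> E) f"
  define f1 where "f1 i j = f0 i j + on g i * f0 a j" for i j
  define f2 where "f2 i j = f1 i j + on h i * f1 b j" for i j
  define f3 where "f3 i j = f2 i j + on u j * f2 i a" for i j
  define f4 where "f4 i j = f3 i j + on v j * f3 i b" for i j
  define r where "r i j = (if i \<in> V \<and> j \<in> V then f i j
      else if i \<in> E \<and> j \<in> E then f i j - g i * f a j - h i * f b j else 0)" for i j
  have "det_fun n f0 = det_fun n f1"
    unfolding f1_def using n on by (intro det_fun_add_row[symmetric])
  also have "\<dots> = det_fun n f2"
    unfolding f2_def using n on by (intro det_fun_add_row[symmetric])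
  also have "\<dots> = det_fun n f3"
    unfolding f3_def using n on by (intro det_fun_add_col[symmetric])
  also have "\<dots> = det_fun n f4"
    unfolding f4_def using n on by (intro det_fun_add_col[symmetric])
  also have "\<dots> = det_fun n (identity_off (V \<union> E) r)"
  proof (rule det_fun_cong)
    fix i j :: nat
    have [simp]: "a \<notin> E" "b \<notin> E" "i \<in> V \<Longrightarrow> i \<notin> E" for i using ab disj by auto
    have f2: "f2 i j = (if i \<in> E then if j \<in> V \<union> E then r i j else f0 i j else f0 i j)" for i j
    proof (cases "i \<in> E \<and> j \<in> V")
      case True
      thus ?thesis using ab disj rows[of i j]
        by (simp add: f2_def f1_def f0_def on_def identity_off_def r_def) auto
    next
      case False
      thus ?thesis using ab
        by (auto simp: f2_def f1_def f0_def on_def identity_off_def r_def)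
    qed
    show "f4 i j = identity_off (V \<union> E) r i j"
    proof (cases "i \<in> V \<and> j \<in> E")
      case True
      thus ?thesis using ab disj cols[of i j]
        by (simp add: f4_def f3_def f2 f0_def on_def identity_off_def r_def) auto
    next
      case False
      thus ?thesis using ab disj
        by (auto simp: f4_def f3_def f2 f0_def on_def identity_off_def r_def)
    qed
  qed
  also have "\<dots> = det_fun n (identity_off V r) * det_fun n (identity_off E r)"
    using disj by (intro det_fun_block_diagonal) (auto simp: r_def)
  also have "identity_off V r = identity_off V f"
    by (auto simp: identity_off_def r_def fun_eq_iff)
  also have "identity_off E r = identity_off E (\<lambda>i j. f i j - g i * f a j - h i * f b j)"
    using disj by (auto simp: identity_off_def r_def fun_eq_iff)
  finally show ?thesis unfolding f0_def .
qed

lemma det_fun_identity_off_scale: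
  assumes "V \<subseteq> {0..<n}"
  shows "det_fun n (identity_off V (\<lambda>i j. l i * f i j * u j))
       = (\<Prod>i\<in>V. l i * u i) * det_fun n (identity_off V f)"
proof -
  let ?l = "\<lambda>i. if i \<in> V then l i else 1" and ?u = "\<lambda>i. if i \<in> V then u i else 1"
  have "identity_off V (\<lambda>i j. l i * f i j * u j) = (\<lambda>i j. ?l i * identity_off V f i j * ?u j)"
    by (auto simp: identity_off_def fun_eq_iff)
  hence "det_fun n (identity_off V (\<lambda>i j. l i * f i j * u j))
      = (\<Prod>i=0..<n. ?l i * ?u i) * det_fun n (identity_off V f)"
    by (simp only: det_fun_scale prod.distrib)
  also have "(\<Prod>i=0..<n. ?l i * ?u i) = (\<Prod>i\<in>V. l i * u i)"
    using assms by (intro prod.mono_neutral_cong_right) auto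
  finally show ?thesis .
qed

text \<open>For the largest element \<open>e\<close> of the set, its row
  \<open>(1, ..., 1, 1 + \<gamma>)\<close> is the sum of a row of ones and \<open>\<gamma>\<close>
  times a unit row. This gives the recursion \<open>s = 1 + \<gamma> * s'\<close> of the geometric
  sum.\<close>

lemma det_fun_identity_off_geometric:
  fixes \<gamma> :: "'a::comm_ring_1"
  assumes "E \<subseteq> {0..<n}"
  shows "det_fun n (identity_off E (\<lambda>i j. if i < j then \<gamma> else if j < i then 1 else 1 + \<gamma>))
       = (\<Sum>k=0..card E. \<gamma> ^ k)"
proof -
  let ?G = "\<lambda>i j. if i < j then \<gamma> else if j < i then 1 else 1 + \<gamma>"
  have "finite E" using assms finite_subset by blast
  thus ?thesis using assms
  proof (induction E rule: finite_linorder_max_induct)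
    case empty
    show ?case by (subst det_fun_lower_triangular) (auto simp: identity_off_def)
  next
    case (insert e E)
    let ?E = "insert e E"
    have e: "e < n" "e \<notin> E" using insert by auto
    define one where "one j = (if j \<in> ?E then 1 else 0 :: 'a)" for j
    define unit where "unit j = (if j = e then \<gamma> else 0)" for j
    define h where "h = identity_off ?E ?G"
    have h_e: "h e j = one j + unit j" for j
      using insert by (auto simp: h_def identity_off_def one_def unit_def)
    have "det_fun n h = det_fun n (\<lambda>i j. if i = e then one j + unit j else h i j)"
      by (rule det_fun_cong) (auto simp: h_e)
    also have "\<dots> = det_fun n (\<lambda>i j. if i = e then one j else h i j)
        + det_fun n (\<lambda>i j. if i = e then unit j else h i j)"
      using e(1) by (rule det_fun_row_add[where h = h])
    also have "det_fun n (\<lambda>i j. if i = e then one j else h i j) = 1"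
    proof -
      let ?f = "\<lambda>i j. if i = e then one j else h i j"
      \<comment> \<open>Subtracting \<open>\<gamma>\<close> times the row of ones removes the
        entries above the diagonal and turns the diagonal into ones.\<close>
      let ?g = "\<lambda>i. if i \<in> E then - \<gamma> else 0"
      have "det_fun n ?f = det_fun n (\<lambda>i j. ?f i j + ?g i * ?f e j)"
        using e by (subst det_fun_add_row) auto
      also have "\<dots> = 1"
        using insert e
        by (subst det_fun_lower_triangular)
          (auto simp: h_def identity_off_def one_def intro!: prod.neutral)
      finally show ?thesis .
    qed
    also have "det_fun n (\<lambda>i j. if i = e then unit j else h i j)
        = \<gamma> * det_fun n (identity_off E ?G)"
    proof -
      let ?l = "\<lambda>i. if i = e then \<gamma> else 1"
      let ?f = "\<lambda>i j. if i = e then if j = e then 1 else 0 else h i j"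
      \<comment> \<open>Here the unit row serves to clear the rest of column \<open>e\<close>, which
        leaves the padded matrix of the smaller set.\<close>
      let ?g = "\<lambda>i. if i \<in> E then - \<gamma> else 0"
      have "det_fun n (\<lambda>i j. if i = e then unit j else h i j)
          = det_fun n (\<lambda>i j. ?l i * ?f i j * 1)"
        by (rule det_fun_cong) (auto simp: unit_def)
      also have "\<dots> = (\<Prod>i=0..<n. ?l i) * det_fun n ?f"
        unfolding det_fun_scale by simp
      also have "(\<Prod>i=0..<n. ?l i) = \<gamma>" using e by simp
      also have "det_fun n ?f = det_fun n (\<lambda>i j. ?f i j + ?g i * ?f e j)"
        using e by (subst det_fun_add_row) auto
      also have "\<dots> = det_fun n (identity_off E ?G)"
        using insert e by (intro det_fun_cong) (auto simp: h_def identity_off_def)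
      finally show ?thesis .
    qed
    also have "det_fun n (identity_off E ?G) = (\<Sum>k=0..card E. \<gamma> ^ k)"
      using insert by simp
    also have "1 + \<gamma> * \<dots> = (\<Sum>k=0..card ?E. \<gamma> ^ k)"
    proof -
      have "card ?E = Suc (card E)" using insert e by simp
      thus ?thesis
        unfolding sum_distrib_left by (simp only: sum.atLeast0_atMost_Suc_shift) (simp add: o_def)
    qed
    finally show ?case unfolding h_def .
  qed
qed

text \<open>The matrix of a single edge, the base case; exchanging rows \<open>a\<close> and
  \<open>b\<close> makes it diagonal.\<close>

lemma det_fun_swap:
  assumes "a < b" "b < n"
  shows "det_fun n (identity_off {a, b} (\<lambda>i j. if i = j then 0 else if i < j then 1 else q)) = - q"
proof -
  let ?f = "identity_off {a, b} (\<lambda>i j. if i = j then 0 else if i < j then 1 else q)"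
  let ?A = "mat n n (\<lambda>(i, j). ?f i j)"
  let ?g = "\<lambda>i j. if i = a then ?f b j else if i = b then ?f a j else ?f i j"
  have "swaprows a b ?A = mat n n (\<lambda>(i, j). ?g i j)"
    using assms by (intro eq_matI) auto
  hence "- det ?A = det_fun n ?g"
    using det_swaprows[of a n b ?A] assms by simp
  also have "\<dots> = (\<Prod>i=0..<n. ?g i i)"
    using assms by (intro det_fun_lower_triangular) (auto simp: identity_off_def)
  also have "\<dots> = (\<Prod>i=0..<n. if i = a then q else 1)"
    using assms by (intro prod.cong) (auto simp: identity_off_def)
  also have "\<dots> = q" using assms by simp
  finally show ?thesis by (simp add: minus_equation_iff[of _ q])
qed

section \<open>Assignments of pieces to vertices\<close>

text \<open>
  The weight of a walk depends only on the assignment of pieces to the set \<open>S\<close> of vertices it passes.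
\<close>

definition allocations :: "nat set set \<Rightarrow> nat set \<Rightarrow> (nat \<Rightarrow> nat set) set" where
  "allocations Ps S = {f \<in> S \<rightarrow>\<^sub>E Ps. (\<forall>v\<in>S. v \<in> f v)
     \<and> (\<forall>P\<in>Ps. card {v \<in> S. f v = P} \<le> card P - 2)}"

definition alloc_sum :: "nat set set \<Rightarrow> (nat set \<Rightarrow> 'a::comm_ring_1) \<Rightarrow> nat set \<Rightarrow> 'a" where
  "alloc_sum Ps x S = (\<Sum>f\<in>allocations Ps S. \<Prod>v\<in>S. x (f v))"

lemma finite_allocations: "finite Ps \<Longrightarrow> finite S \<Longrightarrow> finite (allocations Ps S)"
  unfolding allocations_def by (simp add: finite_PiE)

lemma alloc_sum_empty [simp]: "alloc_sum Ps x {} = 1"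
proof -
  have "allocations Ps {} = {\<lambda>_. undefined}" by (auto simp: allocations_def)
  thus ?thesis by (simp add: alloc_sum_def)
qed

lemma alloc_sum_uncovered:
  assumes "v \<in> S" "v \<notin> \<Union>Ps"
  shows "alloc_sum Ps x S = 0"
proof -
  have "allocations Ps S = {}" using assms by (auto simp: allocations_def)
  thus ?thesis by (simp add: alloc_sum_def)
qed

text \<open>Pigeonhole: a piece serves at most \<open>card P - 2\<close> vertices, so no assignment
  exists.\<close>

lemma alloc_sum_overfull:
  assumes "finite Ps" "finite S" "(\<Sum>P\<in>Ps. card P - 2) < card S"
  shows "alloc_sum Ps x S = 0"
proof -
  have "card S \<le> (\<Sum>P\<in>Ps. card P - 2)" if "f \<in> allocations Ps S" for f
  proof -
    have "card S = card (\<Union>P\<in>Ps. {v \<in> S. f v = P})"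
      using that by (intro arg_cong[where f=card]) (auto simp: allocations_def)
    also have "\<dots> \<le> (\<Sum>P\<in>Ps. card {v \<in> S. f v = P})"
      using assms(1) by (rule card_UN_le)
    also have "\<dots> \<le> (\<Sum>P\<in>Ps. card P - 2)"
      using that by (intro sum_mono) (auto simp: allocations_def)
    finally show ?thesis .
  qed
  hence "allocations Ps S = {}" using assms(3) by force
  thus ?thesis by (simp add: alloc_sum_def)
qed

text \<open>Assignments are sorted by the set \<open>T\<close> of vertices that the new piece
  \<open>Q\<close> serves.\<close>

lemma alloc_sum_insert:
  assumes "finite Ps" "finite S" "Q \<notin> Ps"
  shows "alloc_sum (insert Q Ps) x S
       = (\<Sum>T | T \<subseteq> S \<inter> Q \<and> card T \<le> card Q - 2. x Q ^ card T * alloc_sum Ps x (S - T))"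
proof -
  let ?I = "{T. T \<subseteq> S \<inter> Q \<and> card T \<le> card Q - 2}"
  have fin: "finite ?I" using assms(2) by (auto intro: finite_subset[of _ "Pow S"])
  have "(\<Sum>T\<in>?I. x Q ^ card T * alloc_sum Ps x (S - T))
      = (\<Sum>(T, g)\<in>Sigma ?I (\<lambda>T. allocations Ps (S - T)). x Q ^ card T * (\<Prod>v\<in>S - T. x (g v)))"
    unfolding alloc_sum_def sum_distrib_left
    using fin assms by (subst sum.Sigma) (auto simp: finite_allocations)
  also have "\<dots> = (\<Sum>f\<in>allocations (insert Q Ps) S. \<Prod>v\<in>S. x (f v))"
  \<comment> \<open>\<open>i\<close> splits an assignment into its fibre over \<open>Q\<close> and
    the restriction to the other vertices; \<open>j\<close> puts \<open>Q\<close> back. Since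
    \<open>Q \<notin> Ps\<close>, the fibre is recovered exactly.\<close>
  proof (rule sum.reindex_bij_witness[where
        i = "\<lambda>f. ({v \<in> S. f v = Q}, restrict f (S - {v \<in> S. f v = Q}))" and
        j = "\<lambda>(T, g). \<lambda>v. if v \<in> T then Q else g v"], goal_cases)
    case (1 z)
    then obtain T g where z: "z = (T, g)" "T \<subseteq> S \<inter> Q" "g \<in> allocations Ps (S - T)" by auto
    have T: "{v \<in> S. (if v \<in> T then Q else g v) = Q} = T"
      using z assms(3) by (auto simp: allocations_def PiE_def Pi_def)
    have "restrict (\<lambda>v. if v \<in> T then Q else g v) (S - T) = g"
      using z by (auto simp: allocations_def PiE_def extensional_def restrict_def fun_eq_iff)
    thus ?case unfolding z by (simp add: T)
  next
    case (2 z)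
    then obtain T g where z: "z = (T, g)" "T \<subseteq> S \<inter> Q" "card T \<le> card Q - 2"
        "g \<in> allocations Ps (S - T)" by auto
    let ?f = "\<lambda>v. if v \<in> T then Q else g v"
    have "{v \<in> S. ?f v = Q} = T"
      using z assms(3) by (auto simp: allocations_def PiE_def Pi_def)
    moreover have "{v \<in> S. ?f v = P} = {v \<in> S - T. g v = P}" if "P \<in> Ps" for P
      using that z assms(3) by auto
    ultimately show ?case
      using z by (auto simp: allocations_def PiE_def Pi_def extensional_def)
  next
    case (3 f)
    thus ?case by (auto simp: fun_eq_iff allocations_def)
  next
    case (4 f)
    let ?T = "{v \<in> S. f v = Q}"
    have f: "f \<in> S \<rightarrow>\<^sub>E insert Q Ps" "\<forall>v\<in>S. v \<in> f v" "card ?T \<le> card Q - 2"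
        "\<And>P. P \<in> Ps \<Longrightarrow> card {v \<in> S. f v = P} \<le> card P - 2"
      using 4 by (auto simp: allocations_def)
    have "{v \<in> S - ?T. restrict f (S - ?T) v = P} = {v \<in> S. f v = P}" if "P \<in> Ps" for P
      using that assms(3) by auto
    hence "restrict f (S - ?T) \<in> allocations Ps (S - ?T)"
      using f by (auto simp: allocations_def)
    thus ?case using f by auto
  next
    case (5 z)
    then obtain T g where z: "z = (T, g)" "T \<subseteq> S \<inter> Q" by auto
    have "finite T" "T \<subseteq> S" using z assms(2) by (auto intro: finite_subset)
    hence "(\<Prod>v\<in>S. x (if v \<in> T then Q else g v))
        = (\<Prod>v\<in>S - T. x (if v \<in> T then Q else g v)) * (\<Prod>v\<in>T. x (if v \<in> T then Q else g v))"
      using assms(2) by (intro prod.subset_diff)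
    thus ?case unfolding z by (simp add: mult.commute)
  qed
  finally show ?thesis by (simp add: alloc_sum_def)
qed

text \<open>
  The last edge of the polygon joins the smallest and the largest vertex; nothing is ever glued to it.
\<close>

inductive dissected :: "nat set \<Rightarrow> nat set set \<Rightarrow> bool" where
  edge: "a < b \<Longrightarrow> dissected {a, b} {}"
| glue: "dissected V Ps \<Longrightarrow> a \<in> V \<Longrightarrow> b \<in> V \<Longrightarrow> a < b \<Longrightarrow> V \<inter> {a<..<b} = {}
    \<Longrightarrow> E \<subseteq> {a<..<b} \<Longrightarrow> E \<noteq> {} \<Longrightarrow> dissected (V \<union> E) (insert (insert a (insert b E)) Ps)"

lemma dissected_finite_subset:
  assumes "dissected V Ps"
  shows "finite V" "finite Ps" "\<Union>Ps \<subseteq> V"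
  using assms by (induction rule: dissected.induct) (auto intro: finite_subset)

lemma ear_notin:
  assumes "dissected V Ps" "V \<inter> {a<..<b} = {}" "E \<subseteq> {a<..<b}" "E \<noteq> {}"
  shows "insert a (insert b E) \<notin> Ps"
  using dissected_finite_subset(3)[OF assms(1)] assms by blast

text \<open>The capacity of a glued piece is thus exactly the number of new vertices.\<close>

lemma card_ear:
  fixes a b :: nat
  assumes "a < b" "E \<subseteq> {a<..<b}"
  shows "card (insert a (insert b E)) = card E + 2"
proof -
  have "finite E" using assms(2) finite_subset by blast
  moreover have "a \<notin> E" "b \<notin> E" using assms(2) by auto
  ultimately show ?thesis using assms(1) by simp
qed

text \<open>A gluing adds \<open>card E\<close> both to the total capacity and to the number of
  vertices. Because the capacity stays two short, no assignment serves all vertices but one.\<close>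

lemma dissected_card:
  assumes "dissected V Ps"
  shows "(\<Sum>P\<in>Ps. card P - 2) + 2 = card V"
  using assms
proof (induction rule: dissected.induct)
  case (glue V Ps a b E)
  note fin = dissected_finite_subset[OF glue.hyps(1)]
  have E: "finite E" "V \<inter> E = {}" using glue.hyps finite_subset by blast+
  have "(\<Sum>P\<in>insert (insert a (insert b E)) Ps. card P - 2) = card E + (\<Sum>P\<in>Ps. card P - 2)"
    using fin card_ear[OF \<open>a < b\<close> \<open>E \<subseteq> _\<close>] ear_notin[OF glue.hyps(1,5,6,7)]
    by (subst sum.insert) auto
  thus ?case using glue.IH fin E by (simp add: card_Un_disjoint)
qed simp

section \<open>Assignments after gluing one piece along an edge\<close>

locale ear =
  fixes V Ps a b E and x :: "nat set \<Rightarrow> 'a::field"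
  assumes dissected: "dissected V Ps"
    and a: "a \<in> V" and b: "b \<in> V" and ab: "a < b"
    and gap: "V \<inter> {a<..<b} = {}" and E: "E \<subseteq> {a<..<b}" and E_ne: "E \<noteq> {}"
begin

definition Q :: "nat set" where "Q = insert a (insert b E)"

abbreviation S_old :: "nat set \<Rightarrow> 'a" where "S_old \<equiv> alloc_sum Ps x"
abbreviation S_new :: "nat set \<Rightarrow> 'a" where "S_new \<equiv> alloc_sum (insert Q Ps) x"

lemmas fin = dissected_finite_subset[OF dissected]

lemma fin_E: "finite E" using E finite_subset by blast
lemma disj: "V \<inter> E = {}" using gap E by blast
lemma ab_notin: "a \<notin> E" "b \<notin> E" using E by auto
lemma between: "v \<in> V \<Longrightarrow> v \<le> a \<or> b \<le> v" using gap by force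
lemma E_between: "e \<in> E \<Longrightarrow> a < e \<and> e < b" using E by auto

text \<open>Old vertices lie outside the glued edge and new ones inside; an equation of vertex sets
  is thereby reduced to order arithmetic.\<close>

lemma set_eqI_VE:
  assumes "A \<subseteq> V \<union> E" "B \<subseteq> V \<union> E"
    and "\<And>v. v \<in> V \<Longrightarrow> v \<notin> E \<Longrightarrow> v \<le> a \<or> b \<le> v \<Longrightarrow> v \<in> A \<longleftrightarrow> v \<in> B"
    and "\<And>v. v \<in> E \<Longrightarrow> v \<notin> V \<Longrightarrow> a < v \<Longrightarrow> v < b \<Longrightarrow> v \<in> A \<longleftrightarrow> v \<in> B"
  shows "A = B"
proof -
  have "v \<in> A \<longleftrightarrow> v \<in> B" if "v \<in> V \<union> E" for v
    using that assms(3,4)[of v] between[of v] E_between[of v] disj by (cases "v \<in> V") auto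
  thus ?thesis using assms(1,2) by blast
qed

lemma S_old_overfull: "u \<in> V \<Longrightarrow> V - {u} \<subseteq> S \<Longrightarrow> finite S \<Longrightarrow> S_old S = 0"
proof -
  assume "u \<in> V" "V - {u} \<subseteq> S" "finite S"
  hence "card V - 1 \<le> card S" using fin by (metis card_Diff_singleton card_mono)
  thus ?thesis using dissected_card[OF dissected] fin \<open>finite S\<close>
    by (intro alloc_sum_overfull) auto
qed

text \<open>New vertices lie in no old piece, so \<open>Q\<close> serves all of
  \<open>S \<inter> E\<close>. The only freedom is the set \<open>T\<close> of end points
  \<open>a\<close>, \<open>b\<close> that \<open>Q\<close> serves as well, within its capacity
  \<open>card E\<close>.\<close>

lemma S_new_eq:
  assumes "S \<subseteq> V \<union> E"
  shows "S_new S = (\<Sum>T\<in>Pow (S \<inter> {a, b}). if card (S \<inter> E) + card T \<le> card E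
    then x Q ^ (card (S \<inter> E) + card T) * S_old (S - E - T) else 0)"
proof -
  have finS: "finite S" using assms fin fin_E by (auto intro: finite_subset)
  have cQ: "card Q - 2 = card E" using card_ear[OF ab E] by (simp add: Q_def)
  let ?I = "{T. T \<subseteq> S \<inter> Q \<and> card T \<le> card Q - 2}"
  let ?J = "{T \<in> Pow (S \<inter> {a, b}). card (S \<inter> E) + card T \<le> card E}"
  let ?h = "\<lambda>T. x Q ^ card T * S_old (S - T)"
  have finI: "finite ?I" using finS by (auto intro: finite_subset[of _ "Pow S"])
  have card: "card ((S \<inter> E) \<union> T) = card (S \<inter> E) + card T" if "T \<subseteq> S \<inter> {a, b}" for T
    using that finS ab_notin by (intro card_Un_disjoint) (auto intro: finite_subset)
  have "S_new S = sum ?h ?I"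
    using alloc_sum_insert[OF fin(2) finS, of Q x] ear_notin[OF dissected gap E E_ne]
    by (simp add: Q_def)
  also have "\<dots> = sum ?h ((\<lambda>T. (S \<inter> E) \<union> T) ` ?J)"
  proof (rule sum.mono_neutral_right[OF finI])
    show "(\<lambda>T. (S \<inter> E) \<union> T) ` ?J \<subseteq> ?I"
      using card cQ by (auto simp: Q_def)
    show "\<forall>T\<in>?I - (\<lambda>T. (S \<inter> E) \<union> T) ` ?J. ?h T = 0"
    proof
      fix T assume T: "T \<in> ?I - (\<lambda>T. (S \<inter> E) \<union> T) ` ?J"
      show "?h T = 0"
      proof (cases "S \<inter> E \<subseteq> T")
        case True
        have eq: "T = (S \<inter> E) \<union> (T \<inter> {a, b})" using T True by (auto simp: Q_def)
        have "card T = card (S \<inter> E) + card (T \<inter> {a, b})"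
          using card[of "T \<inter> {a, b}"] eq T by auto
        hence "T \<inter> {a, b} \<in> ?J" using T cQ by auto
        with eq T show ?thesis by blast
      next
        case False
        \<comment> \<open>A new vertex withheld from \<open>Q\<close> cannot be served, so the term
          vanishes.\<close>
        then obtain v where "v \<in> S - T" "v \<in> E" by auto
        thus ?thesis using alloc_sum_uncovered[of v "S - T" Ps x] fin disj by auto
      qed
    qed
  qed
  also have "\<dots> = (\<Sum>T\<in>?J. ?h ((S \<inter> E) \<union> T))"
    using ab_notin by (subst sum.reindex) (auto simp: inj_on_def)
  also have "\<dots> = (\<Sum>T\<in>?J. x Q ^ (card (S \<inter> E) + card T) * S_old (S - E - T))"
    using card by (intro sum.cong arg_cong2[of _ _ _ _ "(*)"] arg_cong[of _ _ S_old]) auto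
  also have "\<dots> = (\<Sum>T\<in>Pow (S \<inter> {a, b}). if card (S \<inter> E) + card T \<le> card E
    then x Q ^ (card (S \<inter> E) + card T) * S_old (S - E - T) else 0)"
    by (subst sum.inter_filter) auto
  finally show ?thesis .
qed

lemma card_Int_E: "card (S \<inter> E) \<le> card E"
  using fin_E by (intro card_mono) auto

text \<open>Only \<open>T = {}\<close> remains. Here and below, the set equations are premises so
  that each use can prove them with \<open>set_eqI_VE\<close>.\<close>

lemma S_new_none:
  assumes "S \<subseteq> V \<union> E" "S \<inter> {a, b} = {}" "S \<inter> E = T" "S - E = U"
  shows "S_new S = x Q ^ card T * S_old U"
  using S_new_eq[OF assms(1)] card_Int_E[of S] unfolding assms(2-4) by simp

text \<open>\<open>E\<close> exhausts \<open>Q\<close>, so \<open>a\<close> and \<open>b\<close> are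
  left to the old pieces.\<close>

lemma S_new_full:
  assumes "S \<subseteq> V \<union> E" "E \<subseteq> S" "S - E = U"
  shows "S_new S = x Q ^ card E * S_old U"
proof -
  have "S \<inter> E = E" using assms by auto
  hence "S_new S = (\<Sum>T\<in>Pow (S \<inter> {a, b}). if T = {} then x Q ^ card E * S_old (S - E) else 0)"
    unfolding S_new_eq[OF assms(1)]
    by (intro sum.cong) (auto simp: card_eq_0_iff intro: finite_subset)
  thus ?thesis using assms(3) by simp
qed

text \<open>The end point \<open>v\<close> goes either to an old piece or to \<open>Q\<close>, which
  still has room for it.\<close>

lemma S_new_one:
  assumes "S \<subseteq> V \<union> E" "S \<inter> {a, b} = {v}" "S \<inter> E = T" "S - E = U" "U - {v} = U'"
    and "card T < card E"
  shows "S_new S = x Q ^ card T * (S_old U + x Q * S_old U')"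
  using assms(6) S_new_eq[OF assms(1)] unfolding assms(2-4)
  by (simp add: Pow_insert algebra_simps assms(5))

text \<open>The old pieces are two short of serving \<open>V\<close>, so \<open>Q\<close> has to
  take both \<open>a\<close> and \<open>b\<close>.\<close>

lemma S_new_around:
  assumes "S \<subseteq> V \<union> E" "V \<subseteq> S" "S \<inter> E = T"
  shows "S_new S = (if card T + 2 \<le> card E then x Q ^ (card T + 2) * S_old (V - {a, b}) else 0)"
proof -
  have eq: "S \<inter> {a, b} = {a, b}" "S - E = V" using assms a b disj by auto
  have "S_old V = 0" "S_old (V - {a}) = 0" "S_old (V - {b}) = 0"
    using a b fin by (auto intro: S_old_overfull)
  moreover have "V - {b, a} = V - {a, b}" by auto
  ultimately show ?thesis using S_new_eq[OF assms(1)] ab unfolding eq assms(3)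
    by (simp add: Pow_insert)
qed

end

text \<open>The remaining vertices are as many as the total capacity, so every piece is used up and
  an assignment can only have this weight. The induction shows that the sum consists of one such
  monomial.\<close>

lemma alloc_sum_Diff_neighbours:
  fixes x :: "nat set \<Rightarrow> 'a::field"
  assumes "dissected V Ps" "u \<in> V" "v \<in> V" "u < v" "V \<inter> {u<..<v} = {}"
  shows "alloc_sum Ps x (V - {u, v}) = (\<Prod>P\<in>Ps. x P ^ (card P - 2))"
  using assms
proof (induction arbitrary: u v rule: dissected.induct)
  case (edge a b)
  thus ?case by (auto simp: insert_Diff_if)
next
  case (glue V Ps a b E)
  interpret ear V Ps a b E x using glue.hyps by unfold_locales
  have prod: "(\<Prod>P\<in>insert Q Ps. x P ^ (card P - 2))
      = x Q ^ card E * (\<Prod>P\<in>Ps. x P ^ (card P - 2))"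
    using ear_notin[OF dissected gap E E_ne] card_ear[OF ab E] fin by (simp add: Q_def)
  have c: "S_old (V - {a, b}) = (\<Prod>P\<in>Ps. x P ^ (card P - 2))"
    using glue.IH[OF a b ab gap] .
  let ?S = "V \<union> E - {u, v}"
  have "S_new ?S = x Q ^ card E * (\<Prod>P\<in>Ps. x P ^ (card P - 2))"
  proof -
    consider "u \<in> V" "v \<in> V" | "u \<in> V" "v \<in> E" | "u \<in> E" "v \<in> V" | "u \<in> E" "v \<in> E"
      using glue.prems by auto
    thus ?thesis
    proof cases
      case 1
      have "?S - E = V - {u, v}" "E \<subseteq> ?S" using 1 disj by auto
      thus ?thesis using S_new_full[of ?S "V - {u, v}"] glue.IH[of u v] glue.prems 1 by auto
    next
      case 2
      \<comment> \<open>No vertex lies between \<open>u\<close> and \<open>v\<close>, and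
        \<open>a\<close> is the last old vertex before \<open>E\<close>.\<close>
      have ua: "u = a"
        using 2 glue.prems between[of u] E_between[of v] a by force
      have k: "?S \<inter> E = E - {v}" "?S - E = V - {a}" "V - {a} - {b} = V - {a, b}"
        "?S \<inter> {a, b} = {b}"
        using 2 ua disj ab b ab_notin by auto
      have "card (E - {v}) + 1 = card E" using 2 fin_E by (metis Suc_eq_plus1 card_Suc_Diff1)
      hence "S_new ?S = x Q ^ card (E - {v}) * (S_old (V - {a}) + x Q * S_old (V - {a, b}))"
        using S_new_one[of ?S b, OF _ k(4,1,2,3)] by auto
      \<comment> \<open>The old pieces cannot serve \<open>V - {a}\<close>, so \<open>b\<close> has
        to go to \<open>Q\<close>.\<close>
      also have "S_old (V - {a}) = 0" using S_old_overfull[OF a] fin by simp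
      finally show ?thesis
        unfolding \<open>card (E - {v}) + 1 = card E\<close>[symmetric] c
        by (simp only: power_add power_one_right add_0_left mult.assoc)
    next
      case 3
      have vb: "v = b"
        using 3 glue.prems between[of v] E_between[of u] b by force
      have k: "?S \<inter> E = E - {u}" "?S - E = V - {b}" "V - {b} - {a} = V - {a, b}"
        "?S \<inter> {a, b} = {a}"
        using 3 vb disj ab a ab_notin by auto
      have "card (E - {u}) + 1 = card E" using 3 fin_E by (metis Suc_eq_plus1 card_Suc_Diff1)
      hence "S_new ?S = x Q ^ card (E - {u}) * (S_old (V - {b}) + x Q * S_old (V - {a, b}))"
        using S_new_one[of ?S a, OF _ k(4,1,2,3)] by auto
      also have "S_old (V - {b}) = 0" using S_old_overfull[OF b] fin by simp
      finally show ?thesis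
        unfolding \<open>card (E - {u}) + 1 = card E\<close>[symmetric] c
        by (simp only: power_add power_one_right add_0_left mult.assoc)
    next
      case 4
      have "?S \<inter> E = E - {u, v}" "V \<subseteq> ?S" using 4 disj by auto
      moreover have "card (E - {u, v}) + 2 = card E"
        using 4 fin_E glue.prems card_mono[of E "{u, v}"] by (simp add: card_Diff_subset)
      ultimately show ?thesis using S_new_around[of ?S] c by auto
    qed
  qed
  thus ?case unfolding prod[unfolded Q_def] by (simp add: Q_def)
qed

section \<open>The determinant of the twisted weight matrix\<close>

text \<open>
  For \<open>i = j\<close> the second case applies; it gives \<open>0\<close> because the pieces cannot serve all vertices but one.
\<close>

definition twisted_weight ::
    "nat set \<Rightarrow> nat set set \<Rightarrow> (nat set \<Rightarrow> 'a::comm_ring_1) \<Rightarrow> 'a \<Rightarrow> nat \<Rightarrow> nat \<Rightarrow> 'a" where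
  "twisted_weight V Ps x q i j =
     (if i < j then alloc_sum Ps x {v \<in> V. i < v \<and> v < j}
      else q * alloc_sum Ps x {v \<in> V. v < j \<or> i < v})"

section \<open>Entries of the glued matrix and their Schur complement\<close>

context ear
begin

text \<open>The weight that a walk collects on \<open>E\<close> when it passes all of it.\<close>

definition y :: 'a where "y = x Q ^ card E"
definition below :: "nat \<Rightarrow> nat" where "below e = card {f \<in> E. f < e}"
definition above :: "nat \<Rightarrow> nat" where "above e = card {f \<in> E. e < f}"

abbreviation w_new :: "'a \<Rightarrow> nat \<Rightarrow> nat \<Rightarrow> 'a" where
  "w_new \<equiv> twisted_weight (V \<union> E) (insert Q Ps) x"
abbreviation w_old :: "'a \<Rightarrow> nat \<Rightarrow> nat \<Rightarrow> 'a" where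
  "w_old q \<equiv> twisted_weight V Ps x (q * y)"

lemma below_above: "e \<in> E \<Longrightarrow> below e + above e + 1 = card E"
proof -
  assume e: "e \<in> E"
  have "E = insert e ({f \<in> E. f < e} \<union> {f \<in> E. e < f})" using e by auto
  also have "card \<dots> = below e + above e + 1"
    unfolding below_def above_def using fin_E by (simp add: card_Un_disjoint disjoint_iff)
  finally show ?thesis by simp
qed

text \<open>The diagonal matrix that conjugates \<open>w_old q\<close> into the block of
  \<open>w_new q\<close> on \<open>V\<close>.\<close>

definition scale :: "nat \<Rightarrow> 'a" where "scale v = (if v \<le> a then y else 1)"

text \<open>A factor \<open>y\<close> is due exactly when the walk passes \<open>E\<close>. If
  \<open>i\<close> and \<open>j\<close> lie on the same side of the edge, these are the entries with
  \<open>j \<le> i\<close>, and the twist \<open>q * y\<close> supplies it; for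
  \<open>i \<le> a\<close>, \<open>b \<le> j\<close> it is \<open>scale i\<close>; for
  \<open>b \<le> i\<close>, \<open>j \<le> a\<close> the walk misses \<open>E\<close>, and
  \<open>scale j\<close> cancels the \<open>y\<close> of the twist.\<close>

lemma w_new_V:
  assumes "x Q \<noteq> 0" "i \<in> V" "j \<in> V"
  shows "w_new q i j = scale i * w_old q i j * inverse (scale j)"
proof -
  have y: "y \<noteq> 0" using assms(1) by (simp add: y_def)
  have full: "S_new S = y * S_old S'" if "S \<subseteq> V \<union> E" "E \<subseteq> S" "S - E = S'" for S S'
    using S_new_full[OF that] by (simp add: y_def)
  have none: "S_new S = S_old S" if "S \<subseteq> V" "a \<notin> S" "b \<notin> S" for S
  proof -
    have "S \<inter> E = {}" "S - E = S" "S \<inter> {a, b} = {}" using that disj by auto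
    thus ?thesis using S_new_none[of S "{}" S] that by auto
  qed
  let ?u = "{v \<in> V \<union> E. i < v \<and> v < j}" and ?l = "{v \<in> V \<union> E. v < j \<or> i < v}"
  let ?u' = "{v \<in> V. i < v \<and> v < j}" and ?l' = "{v \<in> V. v < j \<or> i < v}"
  have old: "?u - E = ?u'" "?l - E = ?l'" using disj by auto
  have new_eq: "w_new q i j = (if i < j then S_new ?u else q * S_new ?l)"
    and old_eq: "w_old q i j = (if i < j then S_old ?u' else q * y * S_old ?l')"
    unfolding twisted_weight_def by simp_all
  consider "i \<le> a" "j \<le> a" | "i \<le> a" "b \<le> j" | "b \<le> i" "j \<le> a" | "b \<le> i" "b \<le> j"
    using between assms by blast
  thus ?thesis
  proof cases
    case 1
    have "?u = ?u'" "E \<subseteq> ?l" using 1 ab E_between by fastforce+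
    hence "S_new ?u = S_old ?u'" "S_new ?l = y * S_old ?l'"
      using none[of ?u'] full[of ?l ?l'] 1 ab old by auto
    thus ?thesis unfolding new_eq old_eq using 1 ab y by (simp add: scale_def)
  next
    case 2
    have "E \<subseteq> ?u" using 2 E_between by fastforce
    hence "S_new ?u = y * S_old ?u'" using full[of ?u ?u'] old by auto
    thus ?thesis unfolding new_eq old_eq using 2 ab y by (simp add: scale_def)
  next
    case 3
    have "?l = ?l'" using 3 E_between by fastforce
    hence "S_new ?l = S_old ?l'" using none[of ?l'] 3 ab by auto
    thus ?thesis unfolding new_eq old_eq using 3 ab y by (simp add: scale_def)
  next
    case 4
    have "?u = ?u'" "E \<subseteq> ?l" using 4 ab E_between by fastforce+
    hence "S_new ?u = S_old ?u'" "S_new ?l = y * S_old ?l'"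
      using none[of ?u'] full[of ?l ?l'] 4 ab old by auto
    thus ?thesis unfolding new_eq old_eq using 4 ab y by (simp add: scale_def)
  qed
qed

lemma S_old_Diff_1: "u \<in> V \<Longrightarrow> S_old (V - {u}) = 0"
  by (rule S_old_overfull) (use fin in auto)

lemma w_old_ab: "w_old q a b = 1"
proof -
  have "{v \<in> V. a < v \<and> v < b} = {}" using gap by auto
  thus ?thesis using ab unfolding twisted_weight_def by (simp only: alloc_sum_empty if_True)
qed

lemma w_old_diag: "i \<in> V \<Longrightarrow> w_old q i i = 0"
proof -
  assume "i \<in> V"
  moreover have "{v \<in> V. v < i \<or> i < v} = V - {i}" by auto
  ultimately show ?thesis using S_old_Diff_1[of i] by (simp add: twisted_weight_def)
qed

text \<open>After \<open>above e\<close> new vertices, all served by \<open>Q\<close>, the walk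
  meets \<open>b\<close>. If an old piece serves \<open>b\<close>, the walk continues like one from
  \<open>a\<close> that has passed \<open>E\<close>, whose weight \<open>y\<close> is divided out;
  if \<open>Q\<close> serves \<open>b\<close>, it continues like one from \<open>b\<close>.\<close>

lemma w_new_row:
  assumes x: "x Q \<noteq> 0" and "e \<in> E" "j \<in> V"
  shows "w_new q e j = x Q ^ above e / y * w_new q a j + x Q ^ (above e + 1) * w_new q b j"
proof -
  have y: "y \<noteq> 0" using x by (simp add: y_def)
  have e: "a < e" "e < b" using E_between assms by auto
  \<comment> \<open>The walk does not pass \<open>e\<close> itself, which leaves room in
    \<open>Q\<close> for \<open>b\<close>.\<close>
  have lt: "above e < card E" using below_above[of e] assms by simp
  consider "j = b" | "b < j" | "j \<le> a" using between[of j] assms by linarith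
  thus ?thesis
  proof cases
    case 1
    let ?S = "{v \<in> V \<union> E. e < v \<and> v < j}"
    have "w_new q e j = S_new ?S" using 1 e by (simp add: twisted_weight_def)
    also have "\<dots> = x Q ^ above e * S_old {}"
      unfolding above_def by (rule S_new_none; (rule set_eqI_VE)?) (use 1 e ab in auto)
    finally have "w_new q e j = x Q ^ above e" by simp
    \<comment> \<open>The walk stops before \<open>b\<close>; accordingly the diagonal entry in row
      \<open>b\<close> is zero.\<close>
    thus ?thesis using 1 a b ab y x w_old_ab w_old_diag
      by (simp add: w_new_V scale_def)
  next
    case 2
    let ?S = "{v \<in> V \<union> E. e < v \<and> v < j}"
    have "w_new q e j = S_new ?S" using 2 e by (simp add: twisted_weight_def)
    also have "\<dots> = x Q ^ above e * (S_old {v \<in> V. a < v \<and> v < j}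
        + x Q * S_old {v \<in> V. b < v \<and> v < j})"
      unfolding above_def
      by (rule S_new_one[where v = b]; (rule set_eqI_VE)?)
        (use 2 e a b ab lt[unfolded above_def] in auto)
    finally show ?thesis
      unfolding w_new_V[OF x a assms(3)] w_new_V[OF x b assms(3)] using 2 e ab y
      by (simp add: scale_def twisted_weight_def algebra_simps)
  next
    case 3
    let ?S = "{v \<in> V \<union> E. v < j \<or> e < v}"
    have "w_new q e j = q * S_new ?S" using 3 e by (simp add: twisted_weight_def)
    also have "S_new ?S = x Q ^ above e * (S_old {v \<in> V. v < j \<or> a < v}
        + x Q * S_old {v \<in> V. v < j \<or> b < v})"
      unfolding above_def
      by (rule S_new_one[where v = b]; (rule set_eqI_VE)?)
        (use 3 e a b ab lt[unfolded above_def] in auto)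
    finally show ?thesis
      unfolding w_new_V[OF x a assms(3)] w_new_V[OF x b assms(3)] using 3 e ab y
      by (simp add: scale_def twisted_weight_def field_simps)
  qed
qed

text \<open>Mirror image of \<open>w_new_row\<close>: the choice is now which piece serves
  \<open>a\<close>.\<close>

lemma w_new_col:
  assumes x: "x Q \<noteq> 0" and "i \<in> V" "e \<in> E"
  shows "w_new q i e = x Q ^ (below e + 1) * w_new q i a + x Q ^ below e / y * w_new q i b"
proof -
  have y: "y \<noteq> 0" using x by (simp add: y_def)
  have e: "a < e" "e < b" using E_between assms by auto
  have lt: "below e < card E" using below_above[of e] assms by simp
  consider "i = a" | "i < a" | "b \<le> i" using between[of i] assms by linarith
  thus ?thesis
  proof cases
    case 1
    let ?S = "{v \<in> V \<union> E. i < v \<and> v < e}"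
    have "w_new q i e = S_new ?S" using 1 e by (simp add: twisted_weight_def)
    also have "\<dots> = x Q ^ below e * S_old {}"
      unfolding below_def by (rule S_new_none; (rule set_eqI_VE)?) (use 1 e ab in auto)
    finally have "w_new q i e = x Q ^ below e" by simp
    thus ?thesis using 1 a b ab y x w_old_ab w_old_diag
      by (simp add: w_new_V scale_def)
  next
    case 2
    let ?S = "{v \<in> V \<union> E. i < v \<and> v < e}"
    have "w_new q i e = S_new ?S" using 2 e by (simp add: twisted_weight_def)
    also have "\<dots> = x Q ^ below e * (S_old {v \<in> V. i < v \<and> v < b}
        + x Q * S_old {v \<in> V. i < v \<and> v < a})"
      unfolding below_def
      by (rule S_new_one[where v = a]; (rule set_eqI_VE)?)
        (use 2 e a b ab lt[unfolded below_def] in auto)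
    finally show ?thesis
      unfolding w_new_V[OF x assms(2) a] w_new_V[OF x assms(2) b] using 2 e ab y
      by (simp add: scale_def twisted_weight_def algebra_simps)
  next
    case 3
    let ?S = "{v \<in> V \<union> E. v < e \<or> i < v}"
    have "w_new q i e = q * S_new ?S" using 3 e by (simp add: twisted_weight_def)
    also have "S_new ?S = x Q ^ below e * (S_old {v \<in> V. v < b \<or> i < v}
        + x Q * S_old {v \<in> V. v < a \<or> i < v})"
      unfolding below_def
      by (rule S_new_one[where v = a]; (rule set_eqI_VE)?)
        (use 3 e a b ab lt[unfolded below_def] in auto)
    finally show ?thesis
      unfolding w_new_V[OF x assms(2) a] w_new_V[OF x assms(2) b] using 3 e ab y
      by (simp add: scale_def twisted_weight_def field_simps)
  qed
qed

text \<open>For \<open>e < f\<close> the walk stays inside \<open>E\<close>. Otherwise it passes all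
  of \<open>V\<close>, and \<open>Q\<close> has to serve \<open>a\<close> and \<open>b\<close> too;
  it has room for them only if \<open>f < e\<close>, so the diagonal vanishes.\<close>

lemma w_new_E:
  assumes "e \<in> E" "f \<in> E"
  shows "w_new q e f =
    (if e < f then x Q ^ card {v \<in> E. e < v \<and> v < f}
     else if f < e then q * (x Q ^ (above e + below f + 2) * S_old (V - {a, b})) else 0)"
proof (cases "e < f")
  case True
  let ?S = "{v \<in> V \<union> E. e < v \<and> v < f}"
  have ef: "a < e" "e < b" "a < f" "f < b" using E_between assms by auto
  have "w_new q e f = S_new ?S" using True by (simp add: twisted_weight_def)
  also have "\<dots> = x Q ^ card {v \<in> E. e < v \<and> v < f} * S_old {}"
    by (rule S_new_none; (rule set_eqI_VE)?) (use ef ab in auto)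
  finally show ?thesis using True by simp
next
  case False
  let ?S = "{v \<in> V \<union> E. v < f \<or> e < v}"
  have "a < e" "e < b" "a < f" "f < b" using E_between assms by auto
  hence V: "V \<subseteq> ?S" using between by fastforce
  have "?S \<inter> E = {v \<in> E. v < f} \<union> {v \<in> E. e < v}" by auto
  moreover have "{v \<in> E. v < f} \<inter> {v \<in> E. e < v} = {}" using False by auto
  ultimately have k: "card (?S \<inter> E) = above e + below f"
    unfolding above_def below_def using fin_E by (simp add: card_Un_disjoint)
  \<comment> \<open>Of the new vertices, \<open>Q\<close> serves those above \<open>e\<close> and
    below \<open>f\<close>; room for two more exists iff \<open>e\<close> and \<open>f\<close> are
    distinct vertices left out.\<close>
  have iff: "above e + below f + 2 \<le> card E \<longleftrightarrow> f < e"
  proof (cases "f < e")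
    case True
    have "card (insert f {v \<in> E. v < f}) \<le> below e"
      unfolding below_def using True assms fin_E by (intro card_mono) auto
    hence "below f + 1 \<le> below e" using fin_E by (simp add: below_def)
    thus ?thesis using below_above[OF assms(1)] True by simp
  next
    case False
    hence "e = f" using \<open>\<not> e < f\<close> by simp
    thus ?thesis using below_above[OF assms(1)] by simp
  qed
  have "S_new ?S = (if f < e then x Q ^ (above e + below f + 2) * S_old (V - {a, b}) else 0)"
    using S_new_around[OF _ V refl] unfolding k iff by blast
  thus ?thesis using False by (simp add: twisted_weight_def)
qed

text \<open>Up to the common factor \<open>x Q ^ above e / y * x Q ^ below f\<close>, the subtracted
  combination is always \<open>1 + \<gamma>\<close>, while \<open>w_new q e f\<close> is
  \<open>1\<close>, \<open>\<gamma>\<close> or \<open>0\<close> for \<open>e < f\<close>,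
  \<open>f < e\<close> or \<open>e = f\<close>.\<close>

lemma w_new_schur:
  fixes q :: 'a
  assumes x: "x Q \<noteq> 0" and ef: "e \<in> E" "f \<in> E"
  defines "\<gamma> \<equiv> q * (y * S_old (V - {a, b})) * x Q ^ 2"
  shows "w_new q e f - x Q ^ above e / y * w_new q a f - x Q ^ (above e + 1) * w_new q b f
    = - (x Q ^ above e / y) * (if e < f then \<gamma> else if f < e then 1 else 1 + \<gamma>) * x Q ^ below f"
proof -
  have y: "y \<noteq> 0" using x by (simp add: y_def)
  have waf: "w_new q a f = x Q ^ below f"
    using w_new_col[OF x a ef(2), of q] a b ab y w_old_ab w_old_diag x
    by (simp add: w_new_V scale_def)
  have "{v \<in> V. v < a \<or> b < v} = V - {a, b}" using between ab by force
  hence wbf: "w_new q b f = q * S_old (V - {a, b}) * x Q ^ (below f + 1)"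
    using w_new_col[OF x b ef(2), of q] a b ab y w_old_diag[OF b, of q] x
    by (simp add: w_new_V scale_def) (simp add: twisted_weight_def)
  \<comment> \<open>Inclusion-exclusion: for \<open>e < f\<close>, the vertices above
    \<open>e\<close> and those below \<open>f\<close> cover \<open>E\<close>.\<close>
  have btw: "x Q ^ card {v \<in> E. e < v \<and> v < f} = x Q ^ above e / y * x Q ^ below f" if "e < f"
  proof -
    have "{v \<in> E. e < v} \<union> {v \<in> E. v < f} = E"
      "{v \<in> E. e < v} \<inter> {v \<in> E. v < f} = {v \<in> E. e < v \<and> v < f}" using that by auto
    hence "above e + below f = card E + card {v \<in> E. e < v \<and> v < f}"
      unfolding above_def below_def using fin_E card_Un_Int[of "{v \<in> E. e < v}" "{v \<in> E. v < f}"]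
      by simp
    thus ?thesis using y by (simp add: y_def field_simps flip: power_add)
  qed
  show ?thesis unfolding w_new_E[OF ef] waf wbf using btw y
    by (auto simp: \<gamma>_def field_simps power2_eq_square power_add)
qed

text \<open>
  The powers of \<open>x Q\<close> in the rows and columns combine to \<open>above e + below e - card E = - 1\<close> for each \<open>e \<in> E\<close>.
\<close>

lemma det_glue:
  assumes x: "x Q \<noteq> 0" and n: "V \<union> E \<subseteq> {0..<n}"
  shows "det_fun n (identity_off (V \<union> E) (w_new q)) =
    det_fun n (identity_off V (w_old q))
    * ((- inverse (x Q)) ^ card E * (\<Sum>k=0..card E. (q * (y * S_old (V - {a, b})) * x Q ^ 2) ^ k))"
proof -
  have y: "y \<noteq> 0" using x by (simp add: y_def)
  let ?\<gamma> = "q * (y * S_old (V - {a, b})) * x Q ^ 2"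
  let ?G = "\<lambda>e f. if e < f then ?\<gamma> else if f < e then 1 else 1 + ?\<gamma>"
  have nV: "V \<subseteq> {0..<n}" and nE: "E \<subseteq> {0..<n}" using n by auto
  have "det_fun n (identity_off (V \<union> E) (w_new q))
    = det_fun n (identity_off V (w_new q)) * det_fun n (identity_off E
       (\<lambda>e f. w_new q e f - x Q ^ above e / y * w_new q a f - x Q ^ (above e + 1) * w_new q b f))"
    using n disj a b x by (intro det_fun_schur[where u = "\<lambda>e. x Q ^ (below e + 1)"
        and v = "\<lambda>e. x Q ^ below e / y"] w_new_row w_new_col) auto
  also have "identity_off V (w_new q)
      = identity_off V (\<lambda>i j. scale i * w_old q i j * inverse (scale j))"
    using w_new_V[OF x] by (auto simp: identity_off_def fun_eq_iff)
  also have "det_fun n \<dots> = det_fun n (identity_off V (w_old q))"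
    unfolding det_fun_identity_off_scale[OF nV] using y by (simp add: scale_def)
  also have "identity_off E (\<lambda>e f. w_new q e f - x Q ^ above e / y * w_new q a f
        - x Q ^ (above e + 1) * w_new q b f)
      = identity_off E (\<lambda>e f. - (x Q ^ above e / y) * ?G e f * x Q ^ below f)"
    using w_new_schur[OF x, of _ _ q] by (auto simp: identity_off_def fun_eq_iff)
  also have "det_fun n \<dots> = (\<Prod>e\<in>E. - (x Q ^ above e / y) * x Q ^ below e)
      * (\<Sum>k=0..card E. ?\<gamma> ^ k)"
    unfolding det_fun_identity_off_scale[OF nE] det_fun_identity_off_geometric[OF nE] ..
  also have "(\<Prod>e\<in>E. - (x Q ^ above e / y) * x Q ^ below e) = (\<Prod>e\<in>E. - inverse (x Q))"
  proof (intro prod.cong refl)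
    fix e assume "e \<in> E"
    hence "card E = above e + below e + 1" using below_above by force
    hence y: "y = x Q ^ above e * x Q ^ below e * x Q"
      unfolding y_def by (simp only: power_add power_one_right)
    show "- (x Q ^ above e / y) * x Q ^ below e = - inverse (x Q)"
      unfolding y using x by (simp add: field_simps)
  qed
  also have "\<dots> = (- inverse (x Q)) ^ card E" by simp
  finally show ?thesis .
qed

end

text \<open>The parameter \<open>q\<close> is general because the old polygon enters with
  \<open>q * y\<close>. As \<open>y\<close> times the old product is the new product, the factors of
  the old pieces already have their final form.\<close>

lemma det_twisted_weight:
  fixes x :: "nat set \<Rightarrow> 'a::field"
  assumes "dissected V Ps" "V \<subseteq> {0..<n}" "\<And>P. P \<in> Ps \<Longrightarrow> x P \<noteq> 0"
  shows "det_fun n (identity_off V (twisted_weight V Ps x q))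
    = (-1) ^ (card V - 1) * q
      * (\<Prod>P\<in>Ps. \<Sum>k=0..card P - 2. (q * (\<Prod>R\<in>Ps. x R ^ (card R - 2)) * x P ^ 2) ^ k)"
  using assms
proof (induction arbitrary: q rule: dissected.induct)
  case (edge a b)
  have "{v \<in> {a, b}. a < v \<and> v < b} = {}" "{v \<in> {a, b}. v < a \<or> b < v} = {}"
    using edge.hyps by auto
  hence 1: "alloc_sum {} x {v \<in> {a, b}. a < v \<and> v < b} = 1"
      "alloc_sum {} x {v \<in> {a, b}. v < a \<or> b < v} = 1" by (simp_all only: alloc_sum_empty)
  have 2: "alloc_sum {} x {v \<in> {a, b}. v < a \<or> a < v} = 0"
      "alloc_sum {} x {v \<in> {a, b}. v < b \<or> b < v} = 0"
    using edge.hyps by (auto intro: alloc_sum_uncovered[of b] alloc_sum_uncovered[of a])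
  have "identity_off {a, b} (twisted_weight {a, b} {} x q)
      = identity_off {a, b} (\<lambda>i j. if i = j then 0 else if i < j then 1 else q)"
    using edge.hyps 1 2 by (auto simp: fun_eq_iff identity_off_def twisted_weight_def)
  thus ?case using det_fun_swap[OF edge.hyps, of n q] edge.hyps edge.prems by simp
next
  case (glue V Ps a b E)
  interpret ear V Ps a b E x using glue.hyps by unfold_locales
  have QPs: "Q \<notin> Ps" using ear_notin[OF dissected gap E E_ne] by (simp add: Q_def)
  have cQ: "card Q - 2 = card E" using card_ear[OF ab E] by (simp add: Q_def)
  have xQ: "x Q \<noteq> 0" using glue.prems(2) by (simp add: Q_def)
  let ?c = "\<Prod>R\<in>Ps. x R ^ (card R - 2)"
  let ?F = "\<lambda>c P. \<Sum>k=0..card P - 2. (q * c * x P ^ 2) ^ k"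
  have c: "(\<Prod>R\<in>insert Q Ps. x R ^ (card R - 2)) = y * ?c"
    using QPs fin cQ by (simp add: y_def)
  have "S_old (V - {a, b}) = ?c"
    by (rule alloc_sum_Diff_neighbours[OF dissected a b ab gap])
  hence "det_fun n (identity_off (V \<union> E) (w_new q))
      = det_fun n (identity_off V (w_old q)) * ((- inverse (x Q)) ^ card E * ?F (y * ?c) Q)"
    using det_glue[OF xQ glue.prems(1), of q] by (simp add: cQ)
  also have "det_fun n (identity_off V (w_old q))
      = (-1) ^ (card V - 1) * (q * y) * (\<Prod>P\<in>Ps. ?F (y * ?c) P)"
    using glue.IH[of "q * y"] glue.prems by (simp add: mult_ac)
  also have "(-1) ^ (card V - 1) * (q * y) * (\<Prod>P\<in>Ps. ?F (y * ?c) P)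
      * ((- inverse (x Q)) ^ card E * ?F (y * ?c) Q)
    = ((-1) ^ (card V - 1) * (y * (- inverse (x Q)) ^ card E)) * q
      * (?F (y * ?c) Q * (\<Prod>P\<in>Ps. ?F (y * ?c) P))"
    by (simp only: mult_ac)
  \<comment> \<open>Each factor \<open>inverse (x Q)\<close> cancels one factor of \<open>y\<close>,
    so only a sign is left.\<close>
  also have "y * (- inverse (x Q)) ^ card E = (-1) ^ card E"
    using xQ by (simp add: y_def flip: power_mult_distrib)
  also have "(-1) ^ (card V - 1) * (-1) ^ card E = ((-1) ^ (card (V \<union> E) - 1) :: 'a)"
  proof -
    have "card V > 0" using a fin card_gt_0_iff by blast
    hence "card (V \<union> E) - 1 = card V - 1 + card E"
      using fin fin_E disj by (simp add: card_Un_disjoint)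
    thus ?thesis by (simp add: power_add)
  qed
  also have "?F (y * ?c) Q * (\<Prod>P\<in>Ps. ?F (y * ?c) P) = (\<Prod>P\<in>insert Q Ps. ?F (y * ?c) P)"
    using QPs fin by simp
  finally show ?case unfolding c[unfolded Q_def] by (simp add: Q_def)
qed

section \<open>Dissections and walks\<close>

text \<open>Unlike \<open>sides\<close>, these do not refer to \<open>n\<close>, so they stay the
  same when vertices are removed.\<close>

definition half_planes :: "nat \<times> nat \<Rightarrow> nat set set" where
  "half_planes = (\<lambda>(a, b). {{a..b}, {..a} \<union> {b..}})"

definition cells :: "nat set \<Rightarrow> (nat \<times> nat) set \<Rightarrow> nat set set" where
  "cells V D = {P. \<exists>s. (\<forall>e\<in>D. s e \<in> half_planes e) \<and> P = V \<inter> (\<Inter>e\<in>D. s e) \<and> 3 \<le> card P}"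

text \<open>If the inner side of \<open>(a, b)\<close> is chosen, every other diagonal must choose
  its side containing \<open>{a..b}\<close>, which gives one cell. If the outer side is chosen, what
  remains is a cell of the polygon without the vertices under \<open>(a, b)\<close>.\<close>

lemma cells_remove:
  assumes V: "finite V" and D: "(a, b) \<in> D" "\<And>c d. (c, d) \<in> D \<Longrightarrow> c < d"
    and ab: "a \<in> V" "b \<in> V" and ne: "V \<inter> {a<..<b} \<noteq> {}"
    and outside: "\<And>c d. (c, d) \<in> D - {(a, b)} \<Longrightarrow> c \<notin> {a<..<b} \<and> d \<notin> {a<..<b}"
  shows "cells V D = insert (V \<inter> {a..b}) (cells (V - {a<..<b}) (D - {(a, b)}))"
proof -
  let ?e = "(a, b)" and ?D = "D - {(a, b)}" and ?V = "V - {a<..<b}"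
  have lt: "a < b" using D by blast
  have Inter_eq: "(\<Inter>e\<in>D. s e) = s ?e \<inter> (\<Inter>e\<in>?D. s e)" for s :: "nat \<times> nat \<Rightarrow> nat set"
    using D(1) by blast
  \<comment> \<open>\<open>s0 e\<close> is the side of \<open>e\<close> that contains
    \<open>{a..b}\<close>.\<close>
  define s0 where "s0 e = (if {a..b} \<subseteq> {fst e..snd e} then {fst e..snd e} else {..fst e} \<union> {snd e..})" for e :: "nat \<times> nat"
  have s0: "s0 e \<in> half_planes e" "{a..b} \<subseteq> s0 e" if "e \<in> D" for e
  proof -
    obtain c d where e: "e = (c, d)" by force
    show "s0 e \<in> half_planes e" by (auto simp: s0_def half_planes_def e)
    show "{a..b} \<subseteq> s0 e"
      using outside[of c d] that lt by (cases "e = ?e") (auto simp: s0_def e)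
  qed
  \<comment> \<open>Any other side meets \<open>{a..b}\<close> in at most \<open>a\<close> and
    \<open>b\<close>, too few for a piece.\<close>
  have other: "s e = s0 e \<or> card (V \<inter> ({a..b} \<inter> s e)) \<le> 2"
    if e: "e \<in> D" "s e \<in> half_planes e" for s e
  proof (rule disjCI)
    assume small: "\<not> card (V \<inter> ({a..b} \<inter> s e)) \<le> 2"
    obtain c d where cd: "e = (c, d)" by force
    show "s e = s0 e"
    proof (rule ccontr)
      assume neq: "s e \<noteq> s0 e"
      have planes: "s e = {c..d} \<or> s e = {..c} \<union> {d..}"
        using e by (simp add: half_planes_def cd)
      have pos: "c \<le> a \<and> b \<le> d \<or> b \<le> c \<or> d \<le> a"
        using e outside[of c d] D(2)[of c d] by (cases "e = ?e") (auto simp: cd not_less)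
      have "{a..b} \<inter> s e \<subseteq> {a, b}"
      proof (cases "c \<le> a \<and> b \<le> d")
        case True
        hence "s0 e = {c..d}" using lt by (simp add: s0_def cd)
        hence "s e = {..c} \<union> {d..}" using planes neq by blast
        thus ?thesis using True by auto
      next
        case False
        hence "s0 e = {..c} \<union> {d..}" using lt by (auto simp: s0_def cd)
        hence "s e = {c..d}" using planes neq by blast
        thus ?thesis using False pos by auto
      qed
      hence "V \<inter> ({a..b} \<inter> s e) \<subseteq> {a, b}" by blast
      hence "card (V \<inter> ({a..b} \<inter> s e)) \<le> card {a, b}" by (intro card_mono) auto
      with small lt show False by simp
    qed
  qed
  have card3: "3 \<le> card (V \<inter> {a..b})"
  proof -
    obtain v where "v \<in> V" "a < v" "v < b" using ne by auto
    hence "card {a, v, b} \<le> card (V \<inter> {a..b})" using V ab by (intro card_mono) auto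
    thus ?thesis using \<open>a < v\<close> \<open>v < b\<close> by simp
  qed
  show ?thesis
  proof (intro equalityI subsetI)
    fix P assume "P \<in> cells V D"
    then obtain s where s: "\<And>e. e \<in> D \<Longrightarrow> s e \<in> half_planes e"
        "P = V \<inter> (\<Inter>e\<in>D. s e)" "3 \<le> card P" by (auto simp: cells_def)
    consider "s ?e = {a..b}" | "s ?e = {..a} \<union> {b..}"
      using s(1)[OF D(1)] by (auto simp: half_planes_def)
    thus "P \<in> insert (V \<inter> {a..b}) (cells ?V ?D)"
    proof cases
      case 1
      have "s e = s0 e" if "e \<in> D" for e
      proof -
        have "P \<subseteq> V \<inter> ({a..b} \<inter> s e)" unfolding s(2) 1[symmetric] using that D(1) by blast
        hence "card P \<le> card (V \<inter> ({a..b} \<inter> s e))" using V by (intro card_mono) auto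
        with s(3) have "\<not> card (V \<inter> ({a..b} \<inter> s e)) \<le> 2" by simp
        with other[OF that, of s] s(1)[OF that] show ?thesis by blast
      qed
      hence "{a..b} \<subseteq> s e" if "e \<in> D" for e using s0(2) that by metis
      hence "P = V \<inter> {a..b}" using s(2) 1 D(1) by auto
      thus ?thesis by simp
    next
      case 2
      have "P = V \<inter> (s ?e \<inter> (\<Inter>e\<in>?D. s e))" unfolding s(2) Inter_eq[of s] ..
      also have "\<dots> = ?V \<inter> (\<Inter>e\<in>?D. s e)" unfolding 2 using lt by auto
      finally have "P \<in> cells ?V ?D" using s unfolding cells_def by blast
      thus ?thesis by simp
    qed
  next
    fix P assume "P \<in> insert (V \<inter> {a..b}) (cells ?V ?D)"
    thus "P \<in> cells V D"
    proof
      assume P: "P = V \<inter> {a..b}"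
      define s where "s = s0(?e := {a..b})"
      have s: "s e \<in> half_planes e" "{a..b} \<subseteq> s e" if "e \<in> D" for e
        using s0[OF that] by (auto simp: s_def half_planes_def)
      have "(\<Inter>e\<in>D. s e) \<subseteq> s ?e" using D(1) by (rule INF_lower)
      moreover have "{a..b} \<subseteq> (\<Inter>e\<in>D. s e)" using s(2) by (rule INF_greatest)
      moreover have "s ?e = {a..b}" by (simp add: s_def)
      ultimately have "P = V \<inter> (\<Inter>e\<in>D. s e)" unfolding P by blast
      moreover have "3 \<le> card P" using card3 P by simp
      ultimately show ?thesis using s(1) unfolding cells_def by (intro CollectI exI[of _ s]) simp
    next
      assume "P \<in> cells ?V ?D"
      then obtain s where s: "\<And>e. e \<in> ?D \<Longrightarrow> s e \<in> half_planes e"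
          "P = ?V \<inter> (\<Inter>e\<in>?D. s e)" "3 \<le> card P" by (auto simp: cells_def)
      define s' where "s' = s(?e := {..a} \<union> {b..})"
      have "s' e \<in> half_planes e" if "e \<in> D" for e
        using s(1) that by (auto simp: s'_def half_planes_def)
      moreover have "P = V \<inter> (\<Inter>e\<in>D. s' e)"
      proof -
        have "(\<Inter>e\<in>?D. s' e) = (\<Inter>e\<in>?D. s e)" by (intro INF_cong) (auto simp: s'_def)
        hence "V \<inter> (\<Inter>e\<in>D. s' e) = V \<inter> ({..a} \<union> {b..}) \<inter> (\<Inter>e\<in>?D. s e)"
          unfolding Inter_eq[of s'] by (simp add: s'_def Int_assoc)
        also have "V \<inter> ({..a} \<union> {b..}) = ?V" using lt by auto
        finally show ?thesis unfolding s(2) ..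
      qed
      ultimately show ?thesis
        using s(3) unfolding cells_def by (intro CollectI exI[of _ s']) simp
    qed
  qed
qed

text \<open>The whole polygon is one piece glued to the edge from \<open>Min V\<close> to
  \<open>Max V\<close>; with two vertices only that edge is left. The set is
  \<open>cells V {}\<close> written out.\<close>

lemma dissected_single:
  assumes "finite V" "2 \<le> card V"
  shows "dissected V {P. P = V \<and> 3 \<le> card P}"
proof -
  have ne: "V \<noteq> {}" using assms by auto
  define a b where "a = Min V" and "b = Max V"
  have ab: "a \<in> V" "b \<in> V" "\<And>v. v \<in> V \<Longrightarrow> a \<le> v \<and> v \<le> b"
    using assms(1) ne by (auto simp: a_def b_def)
  have lt: "a < b"
  proof (rule ccontr)
    assume "\<not> a < b"
    hence "V \<subseteq> {a}" using ab by force
    hence "card V \<le> 1" using card_mono[of "{a}" V] by simp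
    thus False using assms(2) by simp
  qed
  define E where "E = V - {a, b}"
  have V: "V = {a, b} \<union> E" using ab by (auto simp: E_def)
  have E: "E \<subseteq> {a<..<b}"
  proof
    fix v assume "v \<in> E"
    thus "v \<in> {a<..<b}" using ab(3)[of v] by (auto simp: E_def)
  qed
  show ?thesis
  proof (cases "E = {}")
    case True
    hence "V = {a, b}" using V by simp
    moreover from this have "{P. P = V \<and> 3 \<le> card P} = {}" using lt by auto
    ultimately show ?thesis using dissected.edge[OF lt] by metis
  next
    case False
    have "card V = card E + 2" using card_ear[OF lt E] V by simp
    moreover have "card E > 0" using False assms(1) by (simp add: card_gt_0_iff E_def)
    ultimately have "{P. P = V \<and> 3 \<le> card P} = {insert a (insert b E)}" using V by auto
    thus ?thesis
      using dissected.glue[OF dissected.edge[OF lt], of a b E] lt E False V by auto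
  qed
qed

text \<open>
  No diagonal has an endpoint under a diagonal of minimal length, so the latter cuts off a single piece.
\<close>

lemma dissected_cells:
  assumes "finite D" "finite V" "2 \<le> card V"
    and "\<And>a b. (a, b) \<in> D \<Longrightarrow> a \<in> V \<and> b \<in> V \<and> a < b \<and> V \<inter> {a<..<b} \<noteq> {}"
    and "\<And>e f. e \<in> D \<Longrightarrow> f \<in> D \<Longrightarrow> \<not> crossing e f"
  shows "dissected V (cells V D)"
  using assms
proof (induction "card D" arbitrary: D V rule: less_induct)
  case less
  show ?case
  proof (cases "D = {}")
    case True
    thus ?thesis using dissected_single[OF less.prems(2,3)] by (simp add: cells_def)
  next
    case False
    obtain a b where ab: "(a, b) \<in> D"
      and min: "\<And>c d. (c, d) \<in> D \<Longrightarrow> b - a \<le> d - c"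
      using arg_min_if_finite[OF less.prems(1) False, of "\<lambda>(a, b). b - a"]
      by (metis (no_types, lifting) case_prod_conv not_le_imp_less surj_pair)
    let ?V = "V - {a<..<b}" and ?D = "D - {(a, b)}" and ?E = "V \<inter> {a<..<b}"
    note prem = less.prems(4)
    \<comment> \<open>A diagonal with an end point strictly under \<open>(a, b)\<close> could not
      leave \<open>{a..b}\<close> without crossing, so it would be shorter.\<close>
    have outside: "c \<notin> {a<..<b} \<and> d \<notin> {a<..<b}" if "(c, d) \<in> ?D" for c d
      using that min[of c d] prem[of c d] prem[OF ab] less.prems(5)[OF ab, of "(c, d)"]
      by (auto simp: crossing_def)
    \<comment> \<open>If a vertex under \<open>(c, d)\<close> is removed, then \<open>(a, b)\<close>
      lies under \<open>(c, d)\<close>, and \<open>a\<close> or \<open>b\<close> takes the place of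
      that vertex.\<close>
    have "?V \<inter> {c<..<d} \<noteq> {}" if cd: "(c, d) \<in> ?D" for c d
    proof -
      obtain v where v: "v \<in> V" "c < v" "v < d" using cd prem[of c d] by auto
      have "a \<in> V" "b \<in> V" "a < b" using prem[OF ab] by auto
      show ?thesis
      proof (cases "v \<in> {a<..<b}")
        case True
        hence "c < a \<or> b < d" using outside[OF cd] cd v by (auto simp: not_less)
        moreover have "c < b" "a < d" using True v by auto
        moreover have "c \<le> a" "b \<le> d" using True v outside[OF cd] by auto
        ultimately show ?thesis using \<open>a \<in> V\<close> \<open>b \<in> V\<close> \<open>a < b\<close>
          by (metis DiffI IntI empty_iff greaterThanLessThan_iff less_irrefl)
      next
        case False
        thus ?thesis using v by auto
      qed
    qed
    moreover have "2 \<le> card ?V"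
    proof -
      have "card {a, b} \<le> card ?V" using prem[OF ab] less.prems(2) by (intro card_mono) auto
      thus ?thesis using prem[OF ab] by simp
    qed
    moreover have "card ?D < card D" using ab less.prems(1) by (intro card_Diff1_less)
    ultimately have "dissected ?V (cells ?V ?D)"
      using outside prem less.prems by (intro less.hyps) auto
    hence "dissected (?V \<union> ?E) (insert (insert a (insert b ?E)) (cells ?V ?D))"
      using prem[OF ab] by (intro dissected.glue) auto
    moreover have "?V \<union> ?E = V" by auto
    moreover have "insert a (insert b ?E) = V \<inter> {a..b}" using prem[OF ab] by auto
    moreover have "cells V D = insert (V \<inter> {a..b}) (cells ?V ?D)"
      using prem ab less.prems(2) outside by (intro cells_remove) auto
    ultimately show ?thesis by simp
  qed
qed

text \<open>Within \<open>{0..<n}\<close> the sides and the half planes of a diagonal agree, so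
  choices of the one translate into choices of the other.\<close>

lemma pieces_eq_cells:
  assumes "dissection n D"
  shows "pieces n D = cells {0..<n} D"
proof -
  have n: "b < n" "a < n" if "(a, b) \<in> D" for a b
    using assms that by (fastforce simp: dissection_def is_diagonal_def)+
  define clip where "clip h = {0..<n} \<inter> h" for h
  have clip_sides: "clip ` sides n e = clip ` half_planes e" if "e \<in> D" for e
    using n that by (cases e) (auto simp: sides_def half_planes_def clip_def intro!: arg_cong2[where f=insert])
  have clip_Inter: "{0..<n} \<inter> (\<Inter>e\<in>D. s e) = {0..<n} \<inter> (\<Inter>e\<in>D. clip (s e))" for s
    by (auto simp: clip_def)
  have transfer: "\<exists>s'. (\<forall>e\<in>D. s' e \<in> B e) \<and> {0..<n} \<inter> (\<Inter>e\<in>D. s e) = {0..<n} \<inter> (\<Inter>e\<in>D. s' e)"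
    if "\<forall>e\<in>D. s e \<in> A e" "\<And>e. e \<in> D \<Longrightarrow> clip ` A e \<subseteq> clip ` B e" for s A B
  proof -
    have "\<forall>e\<in>D. \<exists>h. h \<in> B e \<and> clip h = clip (s e)"
    proof
      fix e assume "e \<in> D"
      hence "clip (s e) \<in> clip ` B e" using that(1) that(2)[of e] by blast
      thus "\<exists>h. h \<in> B e \<and> clip h = clip (s e)" by (metis imageE)
    qed
    from bchoice[OF this] obtain s' where "\<forall>e\<in>D. s' e \<in> B e \<and> clip (s' e) = clip (s e)" ..
    moreover from this have "(\<Inter>e\<in>D. clip (s e)) = (\<Inter>e\<in>D. clip (s' e))"
      by (intro INF_cong) auto
    ultimately show ?thesis using clip_Inter[of s] clip_Inter[of s'] by (intro exI[of _ s']) simp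
  qed
  show ?thesis
  proof (intro equalityI subsetI)
    fix P assume "P \<in> pieces n D"
    then obtain s where s: "\<forall>e\<in>D. s e \<in> sides n e" "P = {0..<n} \<inter> (\<Inter>e\<in>D. s e)" "3 \<le> card P"
      by (auto simp: pieces_def)
    obtain s' where "\<forall>e\<in>D. s' e \<in> half_planes e" "P = {0..<n} \<inter> (\<Inter>e\<in>D. s' e)"
      using transfer[OF s(1), of half_planes] clip_sides s(2) by auto
    with s(3) show "P \<in> cells {0..<n} D" unfolding cells_def by blast
  next
    fix P assume "P \<in> cells {0..<n} D"
    then obtain s where s: "\<forall>e\<in>D. s e \<in> half_planes e" "P = {0..<n} \<inter> (\<Inter>e\<in>D. s e)" "3 \<le> card P"
      by (auto simp: cells_def)
    obtain s' where "\<forall>e\<in>D. s' e \<in> sides n e" "P = {0..<n} \<inter> (\<Inter>e\<in>D. s' e)"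
      using transfer[OF s(1), of "sides n"] clip_sides s(2) by auto
    with s(3) show "P \<in> pieces n D" unfolding pieces_def by blast
  qed
qed

lemma dissected_pieces:
  assumes "dissection n D" "n \<ge> 2"
  shows "dissected {0..<n} (pieces n D)"
  unfolding pieces_eq_cells[OF assms(1)]
proof (rule dissected_cells)
  have diag: "a < b \<and> b < n \<and> b \<noteq> a + 1" if "(a, b) \<in> D" for a b
    using assms(1) that by (fastforce simp: dissection_def is_diagonal_def)
  have "D \<subseteq> {0..<n} \<times> {0..<n}" using diag by fastforce
  thus "finite D" by (rule finite_subset) simp
  show "a \<in> {0..<n} \<and> b \<in> {0..<n} \<and> a < b \<and> {0..<n} \<inter> {a<..<b} \<noteq> {}" if "(a, b) \<in> D" for a b
  proof -
    have "a + 1 \<in> {0..<n} \<inter> {a<..<b}" using diag[OF that] by auto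
    hence "{0..<n} \<inter> {a<..<b} \<noteq> {}" by blast
    thus ?thesis using diag[OF that] by simp
  qed
  show "\<not> crossing e f" if "e \<in> D" "f \<in> D" for e f
    using assms(1) that by (auto simp: dissection_def)
qed (use assms in auto)

section \<open>Walks as assignments\<close>

lemma sum_lists_alloc:
  assumes \<sigma>: "bij_betw \<sigma> {..<k} S"
  shows "(\<Sum>w\<in>{w. length w = k \<and> set w \<subseteq> Ps \<and> (\<forall>t<k. \<sigma> t \<in> w ! t)
      \<and> (\<forall>P\<in>Ps. count_list w P \<le> card P - 2)}. prod_list (map x w)) = alloc_sum Ps x S"
  unfolding alloc_sum_def
\<comment> \<open>Transport along the enumeration \<open>\<sigma>\<close> of \<open>S\<close>:
  position \<open>t\<close> of the list holds the piece assigned to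
  \<open>\<sigma> t\<close>.\<close>
proof (rule sum.reindex_bij_witness[where
      i = "\<lambda>f. map (f \<circ> \<sigma>) [0..<k]" and
      j = "\<lambda>w. restrict (\<lambda>v. w ! the_inv_into {..<k} \<sigma> v) S"])
  let ?\<tau> = "the_inv_into {..<k} \<sigma>"
  let ?W = "{w. length w = k \<and> set w \<subseteq> Ps \<and> (\<forall>t<k. \<sigma> t \<in> w ! t)
      \<and> (\<forall>P\<in>Ps. count_list w P \<le> card P - 2)}"
  have inj: "inj_on \<sigma> {..<k}" and img: "S = \<sigma> ` {..<k}" using \<sigma> by (auto simp: bij_betw_def)
  have \<tau>: "?\<tau> (\<sigma> t) = t" "\<sigma> t \<in> S" if "t < k" for t
    using that inj img by (auto simp: the_inv_into_f_f)
  have count: "count_list w P = card {v \<in> S. w ! ?\<tau> v = P}" if "length w = k" for w P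
  proof -
    have "count_list w P = card {t. t < k \<and> w ! t = P}"
      using that by (simp add: count_list_eq_length_filter length_filter_conv_card eq_commute)
    also have "\<dots> = card (\<sigma> ` {t. t < k \<and> w ! t = P})"
      using inj by (intro card_image[symmetric]) (auto simp: inj_on_def)
    also have "\<sigma> ` {t. t < k \<and> w ! t = P} = {v \<in> S. w ! ?\<tau> v = P}"
      using \<tau> by (auto simp: img)
    finally show ?thesis .
  qed
  {
    fix w assume w: "w \<in> ?W"
    show "map (restrict (\<lambda>v. w ! ?\<tau> v) S \<circ> \<sigma>) [0..<k] = w"
      using w \<tau> by (intro nth_equalityI) auto
    have "w ! ?\<tau> v \<in> Ps \<and> v \<in> w ! ?\<tau> v" if "v \<in> S" for v
    proof -
      from that img obtain t where "t < k" "v = \<sigma> t" by blast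
      thus ?thesis using w \<tau> by auto
    qed
    moreover have "card {v \<in> S. w ! ?\<tau> v = P} \<le> card P - 2" if "P \<in> Ps" for P
      using w that count[of w P] by auto
    ultimately show "restrict (\<lambda>v. w ! ?\<tau> v) S \<in> allocations Ps S"
      by (auto simp: allocations_def cong: conj_cong)
    have "(\<Prod>v\<in>S. x (restrict (\<lambda>v. w ! ?\<tau> v) S v)) = (\<Prod>t<k. x (w ! t))"
      using \<tau> by (subst prod.reindex_bij_betw[OF \<sigma>, symmetric]) (auto intro!: prod.cong)
    also have "\<dots> = prod_list (map x w)"
      using w by (subst prod.list_conv_set_nth) (auto simp: lessThan_atLeast0)
    finally show "(\<Prod>v\<in>S. x (restrict (\<lambda>v. w ! ?\<tau> v) S v)) = prod_list (map x w)" .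
  next
    fix f assume f: "f \<in> allocations Ps S"
    show eq: "restrict (\<lambda>v. map (f \<circ> \<sigma>) [0..<k] ! ?\<tau> v) S = f"
    proof
      fix v show "restrict (\<lambda>v. map (f \<circ> \<sigma>) [0..<k] ! ?\<tau> v) S v = f v"
        using f \<tau> by (cases "v \<in> S") (auto simp: img allocations_def PiE_def extensional_def)
    qed
    have "{v \<in> S. map (f \<circ> \<sigma>) [0..<k] ! ?\<tau> v = P} = {v \<in> S. f v = P}" for P
      using \<tau> by (auto simp: img)
    thus "map (f \<circ> \<sigma>) [0..<k] \<in> ?W"
      using f \<tau> count[of "map (f \<circ> \<sigma>) [0..<k]"] by (auto simp: allocations_def)
  }
qed

text \<open>The two sets are those of \<open>twisted_weight\<close>: a walk crosses the edge from
  \<open>n - 1\<close> to \<open>0\<close> exactly when \<open>j < i\<close>.\<close>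

lemma walk_vertices:
  fixes i j n :: nat
  assumes "i < n" "j < n" "i \<noteq> j"
  shows "bij_betw (\<lambda>t. (i + 1 + t) mod n) {..<(j + n - i - 1) mod n}
    (if i < j then {v \<in> {0..<n}. i < v \<and> v < j} else {v \<in> {0..<n}. v < j \<or> i < v})"
proof (cases "i < j")
  case True
  have "(j + n - i - 1) mod n = j - i - 1"
  proof -
    have "j + n - i - 1 = j - i - 1 + n" using True by arith
    thus ?thesis using assms by (simp only: mod_add_self2) simp
  qed
  thus ?thesis using True assms
    by (auto intro!: bij_betwI[where g = "\<lambda>v. v - i - 1"])
next
  case False
  hence k: "(j + n - i - 1) mod n = j + n - i - 1" using assms by simp
  \<comment> \<open>A walk goes around less than once, so at most one \<open>n\<close> is
    subtracted.\<close>
  have wrap: "Suc (i + t) mod n = (if Suc (i + t) < n then Suc (i + t) else Suc (i + t) - n)"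
    if "t < j + n - Suc i" for t
    using that assms by (simp add: mod_if)
  show ?thesis using False assms unfolding k
    by (intro bij_betwI[where g = "\<lambda>v. if i < v then v - i - 1 else v + n - i - 1"])
      (auto simp: wrap)
qed

lemma weight_matrix_entry:
  assumes "i < n" "j < n"
  shows "(\<Sum>w\<in>walks n D i j. walk_weight x w)
    = (if i = j then 0 else twisted_weight {0..<n} (pieces n D) x 1 i j)"
proof (cases "i = j")
  case False
  have "walks n D i j = {w. length w = (j + n - i - 1) mod n \<and> set w \<subseteq> pieces n D
      \<and> (\<forall>t<(j + n - i - 1) mod n. (i + 1 + t) mod n \<in> w ! t)
      \<and> (\<forall>P\<in>pieces n D. count_list w P \<le> card P - 2)}"
    using False by (auto simp: walks_def)
  thus ?thesis
    unfolding walk_weight_def using sum_lists_alloc[OF walk_vertices[OF assms False],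
        where Ps = "pieces n D" and x = x] False
    by (simp add: twisted_weight_def)
qed (simp add: walks_def)

text \<open>The case \<open>q = 1\<close>. The values lie in a field and are nonzero because gluing
  divides by them.\<close>

lemma det_weight_matrix:
  fixes x :: "nat set \<Rightarrow> 'a::field"
  assumes "n \<ge> 2" "dissection n D" "\<And>P. P \<in> pieces n D \<Longrightarrow> x P \<noteq> 0"
  defines "c \<equiv> \<Prod>P\<in>pieces n D. x P ^ (card P - 2)"
  shows "det (weight_matrix n D x)
    = (-1) ^ (n - 1) * (\<Prod>P\<in>pieces n D. \<Sum>k=0..card P - 2. (c * x P ^ 2) ^ k)"
proof -
  have dis: "dissected {0..<n} (pieces n D)" using dissected_pieces assms by simp
  note fin = dissected_finite_subset[OF dis]
  have diag: "twisted_weight {0..<n} (pieces n D) x 1 i i = 0" if "i < n" for i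
  proof -
    have "{v \<in> {0..<n}. v < i \<or> i < v} = {0..<n} - {i}" by auto
    moreover have "alloc_sum (pieces n D) x ({0..<n} - {i}) = 0"
      using dissected_card[OF dis] fin that by (intro alloc_sum_overfull) auto
    ultimately show ?thesis by (simp add: twisted_weight_def)
  qed
  have "det (weight_matrix n D x)
      = det_fun n (identity_off {0..<n} (twisted_weight {0..<n} (pieces n D) x 1))"
    unfolding weight_matrix_def
    by (rule det_fun_cong) (auto simp: weight_matrix_entry diag identity_off_def)
  also have "\<dots> = (-1) ^ (n - 1) * (\<Prod>P\<in>pieces n D. \<Sum>k=0..card P - 2. (c * x P ^ 2) ^ k)"
    using det_twisted_weight[OF dis _ assms(3), where n = n and q = 1] by (simp add: c_def)
  finally show ?thesis .
qed

section \<open>Passage to the field of fractions and back\<close>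

lemma Var_neq_0: "Var i \<noteq> 0"
  by (simp add: Var_def single_zero flip: single_zero)

text \<open>For the denominators of the closed form: the product is a monomial in which
  \<open>Var i\<close> has positive exponent, so its constant coefficient is
  \<open>0\<close>.\<close>

lemma monomial_times_Var_sq_neq_1:
  fixes f :: "nat \<Rightarrow> nat"
  shows "(\<Prod>l\<in>A. Var l ^ f l) * Var i ^ 2 \<noteq> 1"
proof -
  define monomial :: "int_mpoly \<Rightarrow> bool" where "monomial p \<longleftrightarrow> (\<exists>k. p = Poly_Mapping.single k 1)" for p
  have one: "monomial 1" unfolding monomial_def by (metis single_one)
  have mult: "monomial (p * q)" if "monomial p" "monomial q" for p q
    using that by (auto simp: monomial_def mult_single)
  have Var: "monomial (Var l)" for l unfolding monomial_def Var_def by blast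
  have "monomial (Var l ^ e)" for l e by (induction e) (use one mult Var in auto)
  hence "monomial (\<Prod>l\<in>A. Var l ^ f l)"
    by (induction A rule: infinite_finite_induct) (use one mult in auto)
  then obtain k where k: "(\<Prod>l\<in>A. Var l ^ f l) = Poly_Mapping.single k 1"
    by (auto simp: monomial_def)
  let ?e = "Poly_Mapping.single i 1 :: nat \<Rightarrow>\<^sub>0 nat"
  have eq: "(\<Prod>l\<in>A. Var l ^ f l) * Var i ^ 2 = Poly_Mapping.single (k + (?e + ?e)) 1"
    unfolding k by (simp add: Var_def power2_eq_square mult_single)
  have "Poly_Mapping.lookup (k + (?e + ?e)) i \<noteq> 0" by (simp add: lookup_add)
  hence "k + (?e + ?e) \<noteq> 0" by (metis lookup_zero)
  hence "Poly_Mapping.lookup ((\<Prod>l\<in>A. Var l ^ f l) * Var i ^ 2) 0 = 0"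
    by (simp add: eq lookup_single)
  thus ?thesis by (metis lookup_one_zero zero_neq_one)
qed

lemma weight_matrix_to_fract:
  "weight_matrix n D (to_fract \<circ> x) = map_mat to_fract (weight_matrix n D x)"
proof -
  have "walk_weight (to_fract \<circ> x) w = to_fract (walk_weight x w)" for w
    by (induction w) (auto simp: walk_weight_def)
  thus ?thesis unfolding weight_matrix_def by (intro eq_matI) auto
qed

theorem theorem4p1:
  fixes n m :: nat
    and D :: "(nat \<times> nat) set"
    and \<alpha> :: "nat \<Rightarrow> nat set"
    and d :: "nat \<Rightarrow> nat"
    and x :: "nat set \<Rightarrow> int_mpoly"
    and c :: int_mpoly
  assumes "n \<ge> 3"
    and "dissection n D"
    and "bij_betw \<alpha> {1..m} (pieces n D)"
    and "\<forall>l\<in>{1..m}. d l = card (\<alpha> l)"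
    and "\<forall>l\<in>{1..m}. x (\<alpha> l) = Var l"
    and "c = (\<Prod>i = 1..m. Var i ^ (d i - 2))"
  shows "det (weight_matrix n D x)
           = (-1) ^ (n - 1) * (\<Prod>i = 1..m. \<Sum>j = 0..d i - 2. (c * Var i ^ 2) ^ j)
       \<and> to_fract (det (weight_matrix n D x))
           = (-1) ^ (n - 1) * (\<Prod>i = 1..m. to_fract ((c * Var i ^ 2) ^ (d i - 1) - 1)
                                          / to_fract (c * Var i ^ 2 - 1))"
proof -
  interpret to_fract: comm_ring_hom "to_fract :: int_mpoly \<Rightarrow> int_mpoly fract"
    by unfold_locales auto
  \<comment> \<open>The determinant is computed over the fraction field, where the indeterminates
    are invertible.\<close>
  let ?x = "to_fract \<circ> x"
  let ?rhs = "(-1) ^ (n - 1) * (\<Prod>i = 1..m. \<Sum>j = 0..d i - 2. (c * Var i ^ 2) ^ j)"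
  have prod_pieces: "(\<Prod>P\<in>pieces n D. g (?x P) (card P)) = (\<Prod>i=1..m. g (to_fract (Var i)) (d i))"
    for g :: "int_mpoly fract \<Rightarrow> nat \<Rightarrow> int_mpoly fract"
    using assms(4,5) by (subst prod.reindex_bij_betw[OF assms(3), symmetric]) (auto intro!: prod.cong)
  have c: "(\<Prod>P\<in>pieces n D. ?x P ^ (card P - 2)) = to_fract c"
    using prod_pieces[of "\<lambda>z e. z ^ (e - 2)"] by (simp add: assms(6) hom_distribs)
  have "?x P \<noteq> 0" if P: "P \<in> pieces n D" for P
  proof -
    from P assms(3) obtain l where "l \<in> {1..m}" "P = \<alpha> l"
      by (metis bij_betw_imp_surj_on imageE)
    thus ?thesis using assms(5) Var_neq_0 by auto
  qed
  hence "to_fract (det (weight_matrix n D x)) = (-1) ^ (n - 1)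
      * (\<Prod>P\<in>pieces n D. \<Sum>j = 0..card P - 2. (to_fract c * ?x P ^ 2) ^ j)"
    using det_weight_matrix[of n D ?x] assms(1,2) c
    by (simp only: weight_matrix_to_fract to_fract.hom_det) simp
  also have "\<dots> = to_fract ?rhs"
    unfolding prod_pieces[of "\<lambda>z e. \<Sum>j = 0..e - 2. (to_fract c * z ^ 2) ^ j"]
    by (simp add: hom_distribs)
  \<comment> \<open>Injectivity of \<open>to_fract\<close> brings the identity back to
    polynomials.\<close>
  finally have det: "det (weight_matrix n D x) = ?rhs" by (simp only: to_fract_eq_iff)
  \<comment> \<open>With truncated subtraction, this makes \<open>{0..d i - 2}\<close> have
    \<open>d i - 1\<close> elements, the length of the geometric sum.\<close>
  have d: "d i \<ge> 3" if "i \<in> {1..m}" for i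
    using assms(3,4) that by (auto simp: bij_betw_def pieces_def)
  have "to_fract (\<Sum>j = 0..d i - 2. (c * Var i ^ 2) ^ j)
      = to_fract ((c * Var i ^ 2) ^ (d i - 1) - 1) / to_fract (c * Var i ^ 2 - 1)"
    if i: "i \<in> {1..m}" for i
  proof -
    let ?z = "c * Var i ^ 2"
    have "{0..d i - 2} = {..<d i - 1}" using d[OF i] by auto
    hence "?z ^ (d i - 1) - 1 = (?z - 1) * (\<Sum>j = 0..d i - 2. ?z ^ j)"
      by (simp only: power_diff_1_eq)
    moreover have "?z - 1 \<noteq> 0"
      using monomial_times_Var_sq_neq_1[where f = "\<lambda>i. d i - 2"] by (simp add: assms(6))
    ultimately show ?thesis
      by (simp only: to_fract.hom_mult) (simp del: to_fract_diff)
  qed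
  hence "to_fract ?rhs = (-1) ^ (n - 1) * (\<Prod>i = 1..m. to_fract ((c * Var i ^ 2) ^ (d i - 1) - 1)
      / to_fract (c * Var i ^ 2 - 1))"
    by (simp only: hom_distribs to_fract.hom_mult to_fract.hom_prod cong: prod.cong)
      simp
  with det show ?thesis by simp
qed

end
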